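(* Assume $\dim\mathfrak X<\infty$ and let $\{V_n:n\in\mathbb N\}$ be a sequence of uncorrelated and identically distributed $\mathcal P_{kc}(\mathfrak X)$-valued random variables with $E[\|V_1\|_{\mathcal P}]<\infty$ and $\mathrm{Var}[\|V_1\|_{\mathcal P}]<\infty$. Then $$d_H\Big(\frac1n\sum_{k=1}^n V_k,\ E[V_1]\Big)\longrightarrow 0\quad\text{as } n\to\infty,\ \text{a.s.}$$
   Context: $(\Omega,\mathcal A,\mu)$ is a complete, non-atomic probability space; $E$, $\mathrm{Var}$, $\mathrm{cov}$ and "a.s." are with respect to $\mu$. $(\mathfrak X,\|\cdot\|)$ is a real separable Banach space with dual $(\mathfrak X^*,\|\cdot\|_{\mathfrak X^*})$. $\mathcal P_{kc}(\mathfrak X)$ is the family of nonempty compact convex subsets of $\mathfrak X$. $A+B=\{a+b:a\in A,b\in B\}$, $\lambda A=\{\lambda a:a\in A\}$; sums of sets are Minkowski sums. The Hausdorff metric is $d_H(A,B)=\max\{\sup_{a\in A}\inf_{b\in B}\|a-b\|,\ \sup_{b\in B}\inf_{a\in A}\|a-b\|\}$, and $\|A\|_{\mathcal P}=d_H(\{0\},A)=\sup_{a\in A}\|a\|$. The support function is $\sigma(x^*,A)=\sup_{a\in A}\langle x^*,a\rangle$, $x^*\in\mathfrak X^*$. A set-valued random variable is a map $F$ from $\Omega$ to the nonempty closed subsets of $\mathfrak X$ with $\{\omega:F(\omega)\cap O\neq\emptyset\}\in\mathcal A$ for every open $O\subset\mathfrak X$; it is $\mathcal P_{kc}(\mathfrak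 X)$-valued if all its values lie in $\mathcal P_{kc}(\mathfrak X)$. Its expectation is the Aumann integral $E[F]=\{E[f]:f\in S_F\}$, where $S_F$ is the set of Bochner integrable $f:\Omega\to\mathfrak X$ with $f(\omega)\in F(\omega)$ a.s. Real random variables $\xi,\eta$ are uncorrelated if $\mathrm{cov}(\xi,\eta)=0$. A sequence of set-valued random variables $\{F_1,F_2,\dots\}$ is (pairwise) uncorrelated if for every $x^*\in\mathfrak X^*$ the real random variables $\sigma(x^*,F_1),\sigma(x^*,F_2),\dots$ are pairwise uncorrelated. "Identically distributed" means having the same law as random elements of the metric space $(\mathcal P_{kc}(\mathfrak X),d_H)$. *)

theory Defs
  imports "HOL-Probability.Probability"
begin

text \<open>Minkowski addition of sets and the corresponding finite sums are the instance of
  \<open>comm_monoid_add\<close> for \<open>set\<close> from \<open>HOL-Library.Set_Algebras\<close>.\<close>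

definition Pkc :: "'a::real_normed_vector set set" where
  "Pkc = {A. A \<noteq> {} \<and> compact A \<and> convex A}"

text \<open>The suprema and infima are taken in the reals, so the value is the Hausdorff distance
  for nonempty bounded arguments only.\<close>

definition hausdorff :: "'a::real_normed_vector set \<Rightarrow> 'a set \<Rightarrow> real" where
  "hausdorff A B =
     max (SUP a\<in>A. INF b\<in>B. norm (a - b)) (SUP b\<in>B. INF a\<in>A. norm (a - b))"

definition normP :: "'a::real_normed_vector set \<Rightarrow> real" where
  "normP A = hausdorff {0} A"

definition support_fun :: "('a::real_normed_vector \<Rightarrow>\<^sub>L real) \<Rightarrow> 'a set \<Rightarrow> real" where
  "support_fun x A = (SUP a\<in>A. blinfun_apply x a)"

text \<open>The locale \<open>Metric_space\<close> asks for nonnegativity on the whole type, hence the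
  value \<open>0\<close> outside \<open>Pkc\<close>, which does not affect the topology on \<open>Pkc\<close>.\<close>

definition Pkc_dist :: "'a::real_normed_vector set \<Rightarrow> 'a set \<Rightarrow> real" where
  "Pkc_dist A B = (if A \<in> Pkc \<and> B \<in> Pkc then hausdorff A B else 0)"

lemma hausdorff_infdist:
  assumes "A \<noteq> {}" "B \<noteq> {}"
  shows "hausdorff A B = max (SUP a\<in>A. infdist a B) (SUP b\<in>B. infdist b A)"
  using assms by (simp add: hausdorff_def infdist_notempty dist_norm norm_minus_commute)

lemma bdd_above_infdist:
  assumes "bounded A" "B \<noteq> {}"
  shows "bdd_above ((\<lambda>a. infdist a B) ` A)"
proof -
  obtain b where b: "b \<in> B" using assms by auto
  obtain e where e: "\<And>a. a \<in> A \<Longrightarrow> dist b a \<le> e"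
    using assms(1) unfolding bounded_any_center[of A b] by auto
  show ?thesis
    by (rule bdd_aboveI2[of _ _ e]) (metis b e infdist_le2 dist_commute)
qed

lemma hausdorff_le_iff:
  assumes "A \<noteq> {}" "B \<noteq> {}" "bounded A" "bounded B"
  shows "hausdorff A B \<le> r \<longleftrightarrow> (\<forall>a\<in>A. infdist a B \<le> r) \<and> (\<forall>b\<in>B. infdist b A \<le> r)"
  using assms by (simp add: hausdorff_infdist cSUP_le_iff bdd_above_infdist)

lemma normP_eq:
  assumes "A \<noteq> {}" "bounded A"
  shows "normP A = (SUP a\<in>A. norm a)"
proof -
  obtain a where a: "a \<in> A" using assms by auto
  have bdd: "bdd_above (norm ` A)"
    using assms(2) by (simp add: bounded_imp_bdd_above bounded_norm_comp)
  have "infdist 0 A \<le> norm a"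
    using infdist_le[OF a, of 0] by simp
  also have "norm a \<le> (SUP a\<in>A. norm a)"
    by (rule cSUP_upper[OF a bdd])
  finally show ?thesis
    using assms by (simp add: normP_def hausdorff_infdist max_def)
qed

lemma Metric_space_Pkc: "Metric_space (Pkc :: 'a::real_normed_vector set set) Pkc_dist"
proof
  have P: "A \<noteq> {} \<and> bounded A \<and> closed A" if "A \<in> Pkc" for A :: "'a set"
    using that by (auto simp: Pkc_def compact_imp_bounded compact_imp_closed)
  fix A B C :: "'a set"
  have nn: "0 \<le> hausdorff A B" if AB: "A \<in> Pkc" "B \<in> Pkc" for A B :: "'a set"
  proof -
    obtain a where "a \<in> A" using P AB by blast
    then have "infdist a B \<le> hausdorff A B"
      using hausdorff_le_iff[of A B "hausdorff A B"] P AB by auto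
    then show ?thesis using infdist_nonneg[of a B] by linarith
  qed
  show "0 \<le> Pkc_dist A B"
    using nn by (simp add: Pkc_dist_def)
  show "Pkc_dist A B = Pkc_dist B A"
    using P by (auto simp: Pkc_dist_def hausdorff_infdist max.commute)
  show "Pkc_dist A B = 0 \<longleftrightarrow> A = B" if AB: "A \<in> Pkc" "B \<in> Pkc"
  proof -
    have z: "infdist x A \<le> 0 \<longleftrightarrow> x \<in> A" if "A \<in> Pkc" for x and A :: "'a set"
      using that P[of A] in_closed_iff_infdist_zero[of A x] infdist_nonneg[of x A] by auto
    have "Pkc_dist A B = 0 \<longleftrightarrow> hausdorff A B \<le> 0"
      using nn[OF AB] AB by (auto simp: Pkc_dist_def)
    also have "\<dots> \<longleftrightarrow> A \<subseteq> B \<and> B \<subseteq> A"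
      using P AB by (auto simp: hausdorff_le_iff z)
    finally show ?thesis by auto
  qed
  show "Pkc_dist A C \<le> Pkc_dist A B + Pkc_dist B C"
    if ABC: "A \<in> Pkc" "B \<in> Pkc" "C \<in> Pkc"
  proof -
    have key: "infdist x C \<le> r + s"
      if "B \<noteq> {}" "infdist x B \<le> r" "\<And>b. b \<in> B \<Longrightarrow> infdist b C \<le> s"
      for x r s and B C :: "'a set"
    proof -
      have "infdist x C - s \<le> dist x b" if "b \<in> B" for b
        using infdist_triangle[of x C b] \<open>\<And>b. b \<in> B \<Longrightarrow> infdist b C \<le> s\<close>[OF that] by linarith
      then have "infdist x C - s \<le> infdist x B"
        using \<open>B \<noteq> {}\<close> by (auto simp: infdist_notempty intro!: cINF_greatest)
      then show ?thesis using \<open>infdist x B \<le> r\<close> by linarith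
    qed
    have 1: "\<forall>a\<in>A. infdist a B \<le> hausdorff A B" "\<forall>b\<in>B. infdist b A \<le> hausdorff A B"
      and 2: "\<forall>b\<in>B. infdist b C \<le> hausdorff B C" "\<forall>c\<in>C. infdist c B \<le> hausdorff B C"
      using hausdorff_le_iff[of A B "hausdorff A B"] hausdorff_le_iff[of B C "hausdorff B C"]
        P ABC by auto
    have "hausdorff A C \<le> hausdorff A B + hausdorff B C"
      using key[of B _ "hausdorff A B" C "hausdorff B C"]
        key[of B _ "hausdorff B C" A "hausdorff A B"] 1 2 P ABC
      by (auto simp: hausdorff_le_iff add.commute)
    then show ?thesis using ABC by (simp add: Pkc_dist_def)
  qed
qed

definition Pkc_borel :: "'a::real_normed_vector set measure" where
  "Pkc_borel = sigma Pkc {U. openin (Metric_space.mtopology Pkc Pkc_dist) U}"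

definition nonatomic :: "'w measure \<Rightarrow> bool" where
  "nonatomic M \<longleftrightarrow>
     (\<forall>A\<in>sets M. emeasure M A > 0 \<longrightarrow>
        (\<exists>B\<in>sets M. B \<subseteq> A \<and> 0 < emeasure M B \<and> emeasure M B < emeasure M A))"

definition set_valued_rv :: "'w measure \<Rightarrow> ('w \<Rightarrow> 'a::real_normed_vector set) \<Rightarrow> bool" where
  "set_valued_rv M F \<longleftrightarrow>
     (\<forall>\<omega>\<in>space M. F \<omega> \<noteq> {} \<and> closed (F \<omega>)) \<and>
     (\<forall>U. open U \<longrightarrow> {\<omega>\<in>space M. F \<omega> \<inter> U \<noteq> {}} \<in> sets M)"

definition Pkc_valued_rv :: "'w measure \<Rightarrow> ('w \<Rightarrow> 'a::real_normed_vector set) \<Rightarrow> bool" where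
  "Pkc_valued_rv M F \<longleftrightarrow> set_valued_rv M F \<and> (\<forall>\<omega>\<in>space M. F \<omega> \<in> Pkc)"

definition aumann_expectation ::
    "'w measure \<Rightarrow> ('w \<Rightarrow> 'a set) \<Rightarrow> 'a::{banach, second_countable_topology} set" where
  "aumann_expectation M F =
     {integral\<^sup>L M f | f. integrable M f \<and> (AE \<omega> in M. f \<omega> \<in> F \<omega>)}"

definition cov :: "'w measure \<Rightarrow> ('w \<Rightarrow> real) \<Rightarrow> ('w \<Rightarrow> real) \<Rightarrow> real" where
  "cov M X Y =
     (\<integral>\<omega>. (X \<omega> - integral\<^sup>L M X) * (Y \<omega> - integral\<^sup>L M Y) \<partial>M)"

text \<open>The integrability conditions say that the covariance exists; without them
  \<open>cov M X Y = 0\<close> would hold by convention for nonintegrable variables.\<close>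

definition uncorrelated :: "'w measure \<Rightarrow> ('w \<Rightarrow> real) \<Rightarrow> ('w \<Rightarrow> real) \<Rightarrow> bool" where
  "uncorrelated M X Y \<longleftrightarrow>
     integrable M X \<and> integrable M Y \<and> integrable M (\<lambda>\<omega>. X \<omega> * Y \<omega>) \<and> cov M X Y = 0"

definition set_uncorrelated ::
    "'w measure \<Rightarrow> nat set \<Rightarrow> (nat \<Rightarrow> 'w \<Rightarrow> 'a::real_normed_vector set) \<Rightarrow> bool" where
  "set_uncorrelated M I F \<longleftrightarrow>
     (\<forall>x :: 'a \<Rightarrow>\<^sub>L real. \<forall>i\<in>I. \<forall>j\<in>I. i \<noteq> j \<longrightarrow>
        uncorrelated M (\<lambda>\<omega>. support_fun x (F i \<omega>)) (\<lambda>\<omega>. support_fun x (F j \<omega>)))"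

text \<open>Compact-valued set-valued random variables in a separable space are measurable with
  respect to \<open>Pkc_borel\<close>, so their laws are given by \<open>distr\<close>.\<close>

definition identically_distributed ::
    "'w measure \<Rightarrow> nat set \<Rightarrow> (nat \<Rightarrow> 'w \<Rightarrow> 'a::real_normed_vector set) \<Rightarrow> bool" where
  "identically_distributed M I F \<longleftrightarrow>
     (\<forall>i\<in>I. \<forall>j\<in>I. distr M Pkc_borel (F i) = distr M Pkc_borel (F j))"

end

theory Submission
  imports Defs "HOL-Library.Discrete_Functions"
begin

text \<open>Support functions turn Minkowski averages into averages of real random variables, so the
  strong law for uncorrelated real variables gives, almost surely and for a countable dense set of
  functionals, convergence of the support functions of the averages to \<open>E[\<sigma>(x, V\<^sub>1)]\<close>. Measurable
  selection identifies this limit as the support function of the Aumann expectation. In finite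
  dimension the unit sphere of functionals has finite nets in the dense set, which upgrades
  pointwise to uniform convergence; uniform closeness of support functions bounds the Hausdorff
  distance by separating a point from a convex set at its nearest point.\<close>

section \<open>Strong law for orthogonal variables\<close>

text \<open>Uncorrelatedness gives second-moment information only, and for one functional at a time:
  the exceptional null set depends on the functional, so only countably many functionals may be
  used. Pointwise convergence of support functions becomes uniform once they are equi-Lipschitz in
  the functional, with a constant governed by the radius of the averages; that radius is bounded by
  means of the convergence at a finite net. Nets and nearest points call for compact balls and an
  inner product, which are obtained by declaring a basis orthonormal; functionals are then indexed
  by vectors, so the dense set lies in the space itself and not in its dual. The sets compared are
  known to be nonempty, convex and bounded, so nearest points are taken in closures. Equality of
  laws is stated through \<open>distr\<close> on the Borel sets of the Hausdorff metric, while a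
  set-valued random variable comes with measurable hitting events; passing from the second to the
  first is what lets moments of support functions be carried from \<open>V 1\<close> to
  \<open>V k\<close>.\<close>

lemma orthogonal_sum_square_integral:
  fixes Y :: "nat \<Rightarrow> 'w \<Rightarrow> real"
  assumes "finite I"
    and int: "\<And>i j. i \<in> I \<Longrightarrow> j \<in> I \<Longrightarrow> integrable M (\<lambda>\<omega>. Y i \<omega> * Y j \<omega>)"
    and orth: "\<And>i j. i \<in> I \<Longrightarrow> j \<in> I \<Longrightarrow> i \<noteq> j \<Longrightarrow> (\<integral>\<omega>. Y i \<omega> * Y j \<omega> \<partial>M) = 0"
    and bound: "\<And>i. i \<in> I \<Longrightarrow> (\<integral>\<omega>. Y i \<omega> * Y i \<omega> \<partial>M) \<le> v"
  shows "integrable M (\<lambda>\<omega>. (\<Sum>i\<in>I. Y i \<omega>)\<^sup>2)"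
    and "(\<integral>\<omega>. (\<Sum>i\<in>I. Y i \<omega>)\<^sup>2 \<partial>M) \<le> v * card I"
proof -
  have eq: "(\<lambda>\<omega>. (\<Sum>i\<in>I. Y i \<omega>)\<^sup>2) = (\<lambda>\<omega>. \<Sum>i\<in>I. \<Sum>j\<in>I. Y i \<omega> * Y j \<omega>)"
    by (simp add: power2_eq_square sum_product)
  show "integrable M (\<lambda>\<omega>. (\<Sum>i\<in>I. Y i \<omega>)\<^sup>2)"
    unfolding eq by (intro Bochner_Integration.integrable_sum int)
  have "(\<integral>\<omega>. (\<Sum>i\<in>I. Y i \<omega>)\<^sup>2 \<partial>M) = (\<Sum>i\<in>I. \<Sum>j\<in>I. \<integral>\<omega>. Y i \<omega> * Y j \<omega> \<partial>M)"
    unfolding eq by (simp add: int Bochner_Integration.integral_sum)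
  also have "\<dots> = (\<Sum>i\<in>I. \<integral>\<omega>. Y i \<omega> * Y i \<omega> \<partial>M)"
  proof (rule sum.cong[OF refl])
    fix i assume i: "i \<in> I"
    have "(\<Sum>j\<in>I. \<integral>\<omega>. Y i \<omega> * Y j \<omega> \<partial>M)
        = (\<Sum>j\<in>I. if j = i then \<integral>\<omega>. Y i \<omega> * Y i \<omega> \<partial>M else 0)"
      by (rule sum.cong) (use i orth in auto)
    then show "(\<Sum>j\<in>I. \<integral>\<omega>. Y i \<omega> * Y j \<omega> \<partial>M) = (\<integral>\<omega>. Y i \<omega> * Y i \<omega> \<partial>M)"
      using i \<open>finite I\<close> by simp
  qed
  also have "\<dots> \<le> v * card I"
    using sum_mono[of I "\<lambda>i. \<integral>\<omega>. Y i \<omega> * Y i \<omega> \<partial>M" "\<lambda>_. v"] bound by (simp add: mult.commute)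
  finally show "(\<integral>\<omega>. (\<Sum>i\<in>I. Y i \<omega>)\<^sup>2 \<partial>M) \<le> v * card I" .
qed

text \<open>By monotone convergence the sum over \<open>n\<close> has finite integral, so it is
  finite almost everywhere and its terms tend to 0. This takes the place of Chebyshev with
  Borel-Cantelli.\<close>

lemma AE_tendsto_0_if_summable_integrals:
  fixes G :: "nat \<Rightarrow> 'w \<Rightarrow> real"
  assumes int: "\<And>n. integrable M (G n)" and nn: "\<And>n \<omega>. 0 \<le> G n \<omega>"
    and sm: "summable (\<lambda>n. integral\<^sup>L M (G n))"
  shows "AE \<omega> in M. (\<lambda>n. G n \<omega>) \<longlonglongrightarrow> 0"
proof -
  have [measurable]: "G n \<in> borel_measurable M" for n using int by auto
  have "(\<integral>\<^sup>+\<omega>. (\<Sum>n. ennreal (G n \<omega>)) \<partial>M) = (\<Sum>n. \<integral>\<^sup>+\<omega>. ennreal (G n \<omega>) \<partial>M)"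
    by (rule nn_integral_suminf) simp
  also have "\<dots> = (\<Sum>n. ennreal (integral\<^sup>L M (G n)))"
    by (simp add: nn_integral_eq_integral int nn)
  also have "\<dots> = ennreal (\<Sum>n. integral\<^sup>L M (G n))"
    by (rule suminf_ennreal2) (use sm nn in auto)
  finally have "(\<integral>\<^sup>+\<omega>. (\<Sum>n. ennreal (G n \<omega>)) \<partial>M) \<noteq> \<infinity>" by simp
  then have "AE \<omega> in M. (\<Sum>n. ennreal (G n \<omega>)) \<noteq> \<infinity>"
    by (intro nn_integral_PInf_AE) auto
  then show ?thesis
    by eventually_elim (intro summable_LIMSEQ_zero summable_suminf_not_top, use nn in auto)
qed

text \<open>Along the squares the normalised partial sums are square summable, and so are their
  oscillations between consecutive squares.\<close>

theorem strong_law_orthogonal: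
  fixes Y :: "nat \<Rightarrow> 'w \<Rightarrow> real"
  assumes int: "\<And>i j. i \<ge> 1 \<Longrightarrow> j \<ge> 1 \<Longrightarrow> integrable M (\<lambda>\<omega>. Y i \<omega> * Y j \<omega>)"
    and orth: "\<And>i j. i \<ge> 1 \<Longrightarrow> j \<ge> 1 \<Longrightarrow> i \<noteq> j \<Longrightarrow> (\<integral>\<omega>. Y i \<omega> * Y j \<omega> \<partial>M) = 0"
    and bound: "\<And>i. i \<ge> 1 \<Longrightarrow> (\<integral>\<omega>. Y i \<omega> * Y i \<omega> \<partial>M) \<le> v"
  shows "AE \<omega> in M. (\<lambda>n. (\<Sum>k\<in>{1..n}. Y k \<omega>) / real n) \<longlonglongrightarrow> 0"
proof -
  define S where "S a b \<omega> = (\<Sum>k\<in>{a<..b}. Y k \<omega>)" for a b \<omega>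
  have "0 \<le> v"
    using order_trans[OF integral_nonneg_AE bound[of 1]] by simp
  have S_int: "integrable M (\<lambda>\<omega>. (S a b \<omega>)\<^sup>2)"
    and S_le: "(\<integral>\<omega>. (S a b \<omega>)\<^sup>2 \<partial>M) \<le> v * real (b - a)" for a b
    unfolding S_def using orthogonal_sum_square_integral[of "{a<..b}" M Y v] int orth bound
    by (auto simp: Suc_le_eq)
  define T where "T N = {N\<^sup>2..<(Suc N)\<^sup>2}" for N :: nat
  \<comment> \<open>The largest oscillation on a block is bounded by the sum over the block: 2N+1
    terms of second moment at most 2vN stay of order N^2 against the divisor N^4 = (N^2)^2. At
    \<open>N = 0\<close> division by zero makes \<open>G 0\<close> vanish.\<close>
  define G where "G N \<omega> = ((S 0 (N\<^sup>2) \<omega>)\<^sup>2 + (\<Sum>k\<in>T N. (S (N\<^sup>2) k \<omega>)\<^sup>2)) / real N ^ 4"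
    for N \<omega>
  have G_int: "integrable M (G N)" for N
    unfolding G_def by (intro integrable_divide Bochner_Integration.integrable_add Bochner_Integration.integrable_sum S_int)
  have G_nn: "0 \<le> G N \<omega>" for N \<omega>
    unfolding G_def by (intro divide_nonneg_nonneg add_nonneg_nonneg sum_nonneg) auto
  \<comment> \<open>For N >= 1 the bound 3N covers both the index gap 2N and the block length 2N+1;
    the constant 10 comes from N^2 + (3N)(3N) = 10 N^2.\<close>
  have G_le: "integral\<^sup>L M (G N) \<le> 10 * v * inverse (real N ^ 2)" if "N \<ge> 1" for N
  proof -
    have "integral\<^sup>L M (G N) =
        ((\<integral>\<omega>. (S 0 (N\<^sup>2) \<omega>)\<^sup>2 \<partial>M) + (\<Sum>k\<in>T N. \<integral>\<omega>. (S (N\<^sup>2) k \<omega>)\<^sup>2 \<partial>M)) / real N ^ 4"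
      unfolding G_def
      by (simp add: S_int Bochner_Integration.integrable_sum Bochner_Integration.integral_sum)
    also have "\<dots> \<le> (v * real N ^ 2 + (\<Sum>k\<in>T N. v * (3 * real N))) / real N ^ 4"
    proof (intro divide_right_mono add_mono sum_mono)
      show "(\<integral>\<omega>. (S 0 (N\<^sup>2) \<omega>)\<^sup>2 \<partial>M) \<le> v * real N ^ 2" using S_le[of 0 "N\<^sup>2"] by simp
      fix k assume "k \<in> T N"
      then have "k - N\<^sup>2 \<le> 3 * N" using that by (auto simp: T_def power2_eq_square)
      then have "v * real (k - N\<^sup>2) \<le> v * (3 * real N)"
        using \<open>0 \<le> v\<close> by (intro mult_left_mono) linarith+
      then show "(\<integral>\<omega>. (S (N\<^sup>2) k \<omega>)\<^sup>2 \<partial>M) \<le> v * (3 * real N)"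
        using S_le[of "N\<^sup>2" k] by linarith
    qed simp
    also have "(\<Sum>k\<in>T N. v * (3 * real N)) \<le> (3 * real N) * (v * (3 * real N))"
    proof -
      have "card (T N) \<le> 3 * N" using that by (simp add: T_def power2_eq_square)
      then have "real (card (T N)) \<le> 3 * real N" by linarith
      then have "real (card (T N)) * (v * (3 * real N)) \<le> 3 * real N * (v * (3 * real N))"
        using \<open>0 \<le> v\<close> by (intro mult_right_mono) auto
      then show ?thesis by simp
    qed
    then have "(v * real N ^ 2 + (\<Sum>k\<in>T N. v * (3 * real N))) / real N ^ 4
       \<le> (v * real N ^ 2 + (3 * real N) * (v * (3 * real N))) / real N ^ 4"
      by (intro divide_right_mono) auto
    also have "\<dots> = 10 * v * inverse (real N ^ 2)"
      using that by (simp add: field_simps power2_eq_square power4_eq_xxxx)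
    finally show ?thesis .
  qed
  have "summable (\<lambda>N. integral\<^sup>L M (G N))"
  proof (rule summable_comparison_test')
    show "summable (\<lambda>N. 10 * v * inverse (real N ^ 2))"
      by (intro summable_mult inverse_power_summable) simp
    show "norm (integral\<^sup>L M (G N)) \<le> 10 * v * inverse (real N ^ 2)" if "N \<ge> 1" for N
      using G_le[OF that] integral_nonneg_AE[of "G N" M] G_nn by simp
  qed
  from AE_tendsto_0_if_summable_integrals[OF G_int G_nn this]
  have "AE \<omega> in M. (\<lambda>N. G N \<omega>) \<longlonglongrightarrow> 0" .
  then show ?thesis
  proof eventually_elim
    fix \<omega> assume lim: "(\<lambda>N. G N \<omega>) \<longlonglongrightarrow> 0"
    have fs: "filterlim floor_sqrt sequentially sequentially"
      unfolding filterlim_at_top eventually_sequentially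
      by (metis le_floor_sqrt_iff)
    have lim2: "(\<lambda>n. 2 * G (floor_sqrt n) \<omega>) \<longlonglongrightarrow> 0"
      using tendsto_mult_right_zero[OF filterlim_compose[OF lim fs]] by simp
    \<comment> \<open>The sum is split at the last square N^2 <= n. The factor 2 comes from (a+b)^2
      <= 2a^2 + 2b^2, and n^2 >= N^4 changes the divisor.\<close>
    have "((\<Sum>k\<in>{1..n}. Y k \<omega>) / real n)\<^sup>2 \<le> 2 * G (floor_sqrt n) \<omega>" if "n \<ge> 1" for n
    proof -
      define N where "N = floor_sqrt n"
      have N: "N \<ge> 1" "N\<^sup>2 \<le> n" "n \<in> T N"
        using that Suc_floor_sqrt_power2_gt[of n] floor_sqrt_greater_zero_iff[of n]
        by (auto simp: N_def T_def Suc_le_eq simp del: floor_sqrt_greater_zero_iff)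
      have "{1..n} = {0<..N\<^sup>2} \<union> {N\<^sup>2<..n}" using N(2) by auto
      then have sum: "(\<Sum>k\<in>{1..n}. Y k \<omega>) = S 0 (N\<^sup>2) \<omega> + S (N\<^sup>2) n \<omega>"
        unfolding S_def by (simp add: sum.union_disjoint)
      have "0 \<le> (S 0 (N\<^sup>2) \<omega> - S (N\<^sup>2) n \<omega>)\<^sup>2" by simp
      then have "(S 0 (N\<^sup>2) \<omega> + S (N\<^sup>2) n \<omega>)\<^sup>2 \<le> 2 * ((S 0 (N\<^sup>2) \<omega>)\<^sup>2 + (S (N\<^sup>2) n \<omega>)\<^sup>2)"
        by (simp add: power2_eq_square algebra_simps)
      also have "(S (N\<^sup>2) n \<omega>)\<^sup>2 \<le> (\<Sum>k\<in>T N. (S (N\<^sup>2) k \<omega>)\<^sup>2)"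
        using N(3) by (intro member_le_sum) (auto simp: T_def)
      finally have sq: "(S 0 (N\<^sup>2) \<omega> + S (N\<^sup>2) n \<omega>)\<^sup>2
          \<le> 2 * ((S 0 (N\<^sup>2) \<omega>)\<^sup>2 + (\<Sum>k\<in>T N. (S (N\<^sup>2) k \<omega>)\<^sup>2))" by simp
      have "real N ^ 2 \<le> real n" using N(2) by (metis of_nat_le_iff of_nat_power)
      then have n4: "real N ^ 4 \<le> (real n)\<^sup>2"
        using power_mono[of "real N ^ 2" "real n" 2] by (simp flip: power_mult)
      have "((\<Sum>k\<in>{1..n}. Y k \<omega>) / real n)\<^sup>2 = (S 0 (N\<^sup>2) \<omega> + S (N\<^sup>2) n \<omega>)\<^sup>2 / (real n)\<^sup>2"
        unfolding sum by (simp add: power_divide)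
      also have "\<dots> \<le> (2 * ((S 0 (N\<^sup>2) \<omega>)\<^sup>2 + (\<Sum>k\<in>T N. (S (N\<^sup>2) k \<omega>)\<^sup>2))) / real N ^ 4"
        using N(1) n4 sq by (intro frac_le) (auto intro!: sum_nonneg add_nonneg_nonneg)
      finally show ?thesis unfolding G_def N_def by simp
    qed
    then have "(\<lambda>n. ((\<Sum>k\<in>{1..n}. Y k \<omega>) / real n)\<^sup>2) \<longlonglongrightarrow> 0"
      by (intro tendsto_sandwich[OF _ _ tendsto_const lim2])
        (auto simp: eventually_sequentially)
    then have "(\<lambda>n. sqrt (((\<Sum>k\<in>{1..n}. Y k \<omega>) / real n)\<^sup>2)) \<longlonglongrightarrow> sqrt 0"
      by (rule tendsto_real_sqrt)
    then show "(\<lambda>n. (\<Sum>k\<in>{1..n}. Y k \<omega>) / real n) \<longlonglongrightarrow> 0"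
      unfolding real_sqrt_abs real_sqrt_zero by (rule tendsto_rabs_zero_cancel)
  qed
qed

section \<open>Hausdorff metric and support functions\<close>

text \<open>Covers nonempty bounded sets in general because the common third set will be a finite
  set of approximating points, usually not convex and hence outside the metric space
  \<open>Pkc\<close>.\<close>

lemma hausdorff_triangle_le:
  assumes "A \<noteq> {}" "B \<noteq> {}" "C \<noteq> {}" "bounded A" "bounded B" "bounded C"
    and AC: "hausdorff A C \<le> r" and BC: "hausdorff B C \<le> s"
  shows "hausdorff A B \<le> r + s"
proof -
  have key: "infdist x Z \<le> r + s"
    if "Y \<noteq> {}" "infdist x Y \<le> r" "\<And>y. y \<in> Y \<Longrightarrow> infdist y Z \<le> s"
    for x and Y Z :: "'a set" and r s
  proof -
    have "infdist x Z - s \<le> dist x y" if "y \<in> Y" for y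
      using infdist_triangle[of x Z y] \<open>\<And>y. y \<in> Y \<Longrightarrow> infdist y Z \<le> s\<close>[OF that] by linarith
    then have "infdist x Z - s \<le> infdist x Y"
      using \<open>Y \<noteq> {}\<close> by (auto simp: infdist_notempty intro!: cINF_greatest)
    then show ?thesis using \<open>infdist x Y \<le> r\<close> by linarith
  qed
  show ?thesis
    using key[of C _ r B s] key[of C _ s A r] assms by (auto simp: hausdorff_le_iff add.commute)
qed

section \<open>Measurability with respect to the Hausdorff metric\<close>

lemma infdist_set_valued_measurable:
  assumes "set_valued_rv M F"
  shows "(\<lambda>\<omega>. infdist x (F \<omega>)) \<in> borel_measurable M"
proof (rule borel_measurableI_less)
  fix r
  have "{\<omega> \<in> space M. infdist x (F \<omega>) < r} = {\<omega> \<in> space M. F \<omega> \<inter> ball x r \<noteq> {}}"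
  proof (rule Collect_cong, rule conj_cong[OF refl])
    fix \<omega> assume "\<omega> \<in> space M"
    then have ne: "F \<omega> \<noteq> {}" using assms by (auto simp: set_valued_rv_def)
    show "infdist x (F \<omega>) < r \<longleftrightarrow> F \<omega> \<inter> ball x r \<noteq> {}"
      using cINF_less_iff[of "F \<omega>" "\<lambda>y. dist x y" r] ne by (auto simp: infdist_notempty)
  qed
  then show "{\<omega> \<in> space M. infdist x (F \<omega>) < r} \<in> sets M"
    using assms by (simp add: set_valued_rv_def)
qed

text \<open>A finite centre keeps both halves measurable: the bound on the points of
  \<open>C\<close> is a finite conjunction, and the bound on the points of \<open>F\<close> says
  that the open set of points farther than \<open>r\<close> from \<open>C\<close> is missed.\<close>

lemma hausdorff_finite_measurable:
  assumes F: "Pkc_valued_rv M F" and C: "finite C" "C \<noteq> {}"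
  shows "{\<omega> \<in> space M. hausdorff (F \<omega>) C \<le> r} \<in> sets M"
proof -
  have rv: "set_valued_rv M F" using F by (simp add: Pkc_valued_rv_def)
  note [measurable] = infdist_set_valued_measurable[OF rv]
  let ?U = "{x. r < infdist x C}"
  have "open ?U" by (intro open_Collect_less continuous_intros)
  then have "{\<omega> \<in> space M. F \<omega> \<inter> ?U \<noteq> {}} \<in> sets M" using rv by (simp add: set_valued_rv_def)
  moreover have "{\<omega> \<in> space M. \<forall>c\<in>C. infdist c (F \<omega>) \<le> r} \<in> sets M"
    using C(1) by measurable
  moreover have "{\<omega> \<in> space M. hausdorff (F \<omega>) C \<le> r} =
      {\<omega> \<in> space M. \<forall>c\<in>C. infdist c (F \<omega>) \<le> r} - {\<omega> \<in> space M. F \<omega> \<inter> ?U \<noteq> {}}"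
  proof -
    have "hausdorff (F \<omega>) C \<le> r \<longleftrightarrow>
        (\<forall>c\<in>C. infdist c (F \<omega>) \<le> r) \<and> F \<omega> \<inter> ?U = {}" if "\<omega> \<in> space M" for \<omega>
    proof -
      have "F \<omega> \<noteq> {}" "bounded (F \<omega>)"
        using F that by (auto simp: Pkc_valued_rv_def Pkc_def compact_imp_bounded)
      then show ?thesis
        using C by (auto simp: hausdorff_le_iff finite_imp_bounded not_less)
    qed
    then show ?thesis by auto
  qed
  ultimately show ?thesis by simp
qed

lemma compact_hausdorff_approx_finite:
  fixes A :: "'a::real_normed_vector set"
  assumes "compact A" "A \<noteq> {}" "e > 0"
    and dense: "\<And>U. open U \<Longrightarrow> U \<noteq> {} \<Longrightarrow> \<exists>d\<in>D. d \<in> U"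
  obtains C where "finite C" "C \<subseteq> D" "C \<noteq> {}" "hausdorff A C \<le> e"
proof -
  have "A \<subseteq> (\<Union>d\<in>D. ball d e)"
  proof
    fix a assume "a \<in> A"
    obtain d where "d \<in> D" "d \<in> ball a e"
      using dense[of "ball a e"] \<open>e > 0\<close> by auto
    then show "a \<in> (\<Union>d\<in>D. ball d e)" by (auto simp: dist_commute)
  qed
  then obtain F where F: "F \<subseteq> D" "finite F" "A \<subseteq> (\<Union>d\<in>F. ball d e)"
    using compactE_image[of A D "\<lambda>d. ball d e"] \<open>compact A\<close> open_ball by metis
  \<comment> \<open>Centres whose ball misses \<open>A\<close> may be far from \<open>A\<close> and
    would spoil the second half of the Hausdorff bound.\<close>
  define C where "C = {d \<in> F. ball d e \<inter> A \<noteq> {}}"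
  have 1: "\<exists>d\<in>C. dist a d \<le> e" if a: "a \<in> A" for a
  proof -
    obtain d where "d \<in> F" "a \<in> ball d e" using F(3) a by blast
    then have "d \<in> C" "dist a d \<le> e"
      using a unfolding C_def by (blast, simp add: dist_commute)
    then show ?thesis by blast
  qed
  have 2: "\<exists>a\<in>A. dist d a \<le> e" if "d \<in> C" for d
    using that unfolding C_def by (force intro: less_imp_le)
  have "C \<noteq> {}" using 1 \<open>A \<noteq> {}\<close> by blast
  moreover have "finite C" using F(2) by (simp add: C_def)
  moreover have "hausdorff A C \<le> e"
    using 1 2 \<open>A \<noteq> {}\<close> \<open>C \<noteq> {}\<close> \<open>finite C\<close> \<open>compact A\<close>
    by (auto simp: hausdorff_le_iff compact_imp_bounded finite_imp_bounded intro: infdist_le2)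
  ultimately show ?thesis using that[of C] F(1) by (auto simp: C_def)
qed

lemma PkcD:
  assumes "A \<in> Pkc"
  shows "A \<noteq> {}" "compact A" "convex A" "bounded A" "closed A"
  using assms by (auto simp: Pkc_def compact_imp_bounded compact_imp_closed)

lemma openin_Pkc_subset: "{U. openin (Metric_space.mtopology Pkc Pkc_dist) U} \<subseteq> Pow Pkc"
  by (auto simp: Metric_space.openin_mtopology[OF Metric_space_Pkc])

lemma space_Pkc_borel [simp]: "space Pkc_borel = Pkc"
  unfolding Pkc_borel_def by (rule space_measure_of) (rule openin_Pkc_subset)

text \<open>An open set of the Hausdorff metric is a countable union of sets of the form
  \<open>hausdorff A C \<le> q\<close>, with \<open>C\<close> a finite subset of a countable dense
  set and \<open>q\<close> rational, and these have measurable preimages. Only with this is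
  \<open>distr M Pkc_borel\<close> a genuine law.\<close>

theorem Pkc_valued_rv_measurable:
  fixes F :: "'w \<Rightarrow> 'a::{real_normed_vector, second_countable_topology} set"
  assumes F: "Pkc_valued_rv M F"
  shows "F \<in> measurable M Pkc_borel"
  unfolding Pkc_borel_def
proof (rule measurable_measure_of[OF openin_Pkc_subset])
  have Pkc: "F \<omega> \<in> Pkc" if "\<omega> \<in> space M" for \<omega> using F that by (simp add: Pkc_valued_rv_def)
  then show "F \<in> space M \<rightarrow> Pkc" by auto
  obtain D :: "'a set" where D: "countable D" "\<And>U. open U \<Longrightarrow> U \<noteq> {} \<Longrightarrow> \<exists>d\<in>D. d \<in> U"
    using countable_dense_setE by blast
  define I where "I = {C. C \<subseteq> D \<and> finite C} \<times> (\<rat> :: real set)"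
  have "countable I"
    unfolding I_def using countable_Collect_finite_subset[OF D(1)]
    by (intro countable_SIGMA countable_rat) (simp_all add: conj_commute)
  fix U :: "'a set set" assume "U \<in> {U. openin (Metric_space.mtopology Pkc Pkc_dist) U}"
  then have U: "U \<subseteq> Pkc"
    "\<And>A. A \<in> U \<Longrightarrow> \<exists>r>0. Metric_space.mball Pkc Pkc_dist A r \<subseteq> U"
    by (auto simp: Metric_space.openin_mtopology[OF Metric_space_Pkc])
  \<comment> \<open>Admissible pairs are singled out by the inclusion in \<open>U\<close> itself:
    the finite centres need not belong to \<open>Pkc\<close>, so they have no ball in that metric
    space.\<close>
  define J where "J = {(C, q) \<in> I. C \<noteq> {} \<and> (\<forall>A\<in>Pkc. hausdorff A C \<le> q \<longrightarrow> A \<in> U)}"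
  have "F -` U \<inter> space M = (\<Union>(C, q)\<in>J. {\<omega> \<in> space M. hausdorff (F \<omega>) C \<le> q})"
  proof (intro equalityI subsetI)
    fix \<omega> assume "\<omega> \<in> F -` U \<inter> space M"
    then have \<omega>: "\<omega> \<in> space M" "F \<omega> \<in> U" by auto
    note P = PkcD[OF Pkc[OF \<omega>(1)]]
    obtain r where r: "r > 0" "Metric_space.mball Pkc Pkc_dist (F \<omega>) r \<subseteq> U"
      using U(2)[OF \<omega>(2)] by blast
    \<comment> \<open>Two sets within \<open>q\<close> of the same \<open>C\<close> are within
      \<open>q + q < r\<close> of each other.\<close>
    obtain q where q: "q \<in> \<rat>" "0 < q" "q < r / 2"
      using Rats_dense_in_real[of 0 "r / 2"] r(1) by auto
    obtain C where C: "finite C" "C \<subseteq> D" "C \<noteq> {}" "hausdorff (F \<omega>) C \<le> q"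
      by (rule compact_hausdorff_approx_finite[OF P(2,1) q(2) D(2)])
    have "A \<in> U" if A: "A \<in> Pkc" "hausdorff A C \<le> q" for A
    proof -
      have "hausdorff (F \<omega>) A \<le> q + q"
        using P PkcD[OF A(1)] C A(2)
        by (intro hausdorff_triangle_le[of _ _ C]) (auto simp: finite_imp_bounded)
      then have "A \<in> Metric_space.mball Pkc Pkc_dist (F \<omega>) r"
        using q(3) A(1) Pkc[OF \<omega>(1)]
        by (simp add: Metric_space.in_mball[OF Metric_space_Pkc] Pkc_dist_def)
      then show ?thesis using r(2) by blast
    qed
    then have "(C, q) \<in> J" using C q by (simp add: J_def I_def)
    then show "\<omega> \<in> (\<Union>(C, q)\<in>J. {\<omega> \<in> space M. hausdorff (F \<omega>) C \<le> q})"
      using \<omega>(1) C(4) by blast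
  qed (use Pkc in \<open>auto simp: J_def\<close>)
  also have "\<dots> \<in> sets M"
  proof (rule sets.countable_UN'')
    show "countable J" by (rule countable_subset[OF _ \<open>countable I\<close>]) (auto simp: J_def)
    show "(case j of (C, q) \<Rightarrow> {\<omega> \<in> space M. hausdorff (F \<omega>) C \<le> q}) \<in> sets M" if "j \<in> J" for j
      using that hausdorff_finite_measurable[OF F] by (auto simp: J_def I_def)
  qed
  finally show "F -` U \<inter> space M \<in> sets M" .
qed

section \<open>Support functions on compact convex sets\<close>

lemma support_fun_upper:
  assumes "bounded A" "a \<in> A"
  shows "blinfun_apply x a \<le> support_fun x A"
  unfolding support_fun_def
  using assms by (intro cSUP_upper bounded_imp_bdd_above bounded_linear_image
      blinfun.bounded_linear_right)

lemma support_fun_least: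
  assumes "A \<noteq> {}" "\<And>a. a \<in> A \<Longrightarrow> blinfun_apply x a \<le> r"
  shows "support_fun x A \<le> r"
  unfolding support_fun_def using assms by (rule cSUP_least)

text \<open>At each \<open>a\<close> the functional exceeds its supremum over \<open>B\<close> by at
  most \<open>norm x\<close> times the distance to any point of \<open>B\<close>; dividing by
  \<open>norm x\<close> lets this pass to the infimum, hence the separate case
  \<open>norm x = 0\<close>.\<close>

lemma support_fun_hausdorff:
  assumes "A \<in> Pkc" "B \<in> Pkc"
  shows "support_fun x A \<le> support_fun x B + norm x * hausdorff A B"
proof (rule support_fun_least)
  note A = PkcD[OF assms(1)] and B = PkcD[OF assms(2)]
  show "A \<noteq> {}" by (rule A)
  fix a assume a: "a \<in> A"
  have le: "blinfun_apply x a - support_fun x B \<le> norm x * dist a b" if "b \<in> B" for b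
    using support_fun_upper[OF B(4) that, of x] norm_blinfun[of x "a - b"]
    by (simp add: blinfun.diff_right dist_norm)
  have "blinfun_apply x a - support_fun x B \<le> norm x * infdist a B"
  proof (cases "norm x = 0")
    case False
    then have "(blinfun_apply x a - support_fun x B) / norm x \<le> dist a b" if "b \<in> B" for b
      using le[OF that] by (simp add: field_simps)
    then have "(blinfun_apply x a - support_fun x B) / norm x \<le> infdist a B"
      using B(1) by (auto simp: infdist_notempty intro!: cINF_greatest)
    then show ?thesis using False by (simp add: field_simps)
  qed (use le B(1) in auto)
  also have "\<dots> \<le> norm x * hausdorff A B"
    using hausdorff_le_iff[OF A(1) B(1) A(4) B(4), of "hausdorff A B"] a
    by (intro mult_left_mono) auto
  finally show "blinfun_apply x a \<le> support_fun x B + norm x * hausdorff A B" by simp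
qed

lemma support_fun_borel_measurable [measurable]:
  "support_fun x \<in> borel_measurable Pkc_borel"
proof (rule borel_measurableI)
  fix S :: "real set" assume "open S"
  interpret Metric_space "Pkc :: 'a set set" Pkc_dist by (rule Metric_space_Pkc)
  have "openin mtopology (support_fun x -` S \<inter> Pkc)"
    unfolding openin_mtopology
  proof (intro conjI allI impI)
    fix A assume "A \<in> support_fun x -` S \<inter> Pkc"
    then have A: "support_fun x A \<in> S" "A \<in> Pkc" by auto
    obtain e where e: "e > 0" "ball (support_fun x A) e \<subseteq> S"
      using \<open>open S\<close> A(1) by (meson openE)
    \<comment> \<open>The 1 in the denominator keeps the radius positive when
      \<open>x = 0\<close>.\<close>
    have "mball A (e / (1 + norm x)) \<subseteq> support_fun x -` S \<inter> Pkc"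
    proof
      fix B assume "B \<in> mball A (e / (1 + norm x))"
      then have B: "B \<in> Pkc" "Pkc_dist A B < e / (1 + norm x)" by auto
      have "\<bar>support_fun x A - support_fun x B\<bar> \<le> norm x * Pkc_dist A B"
        using support_fun_hausdorff[OF A(2) B(1), of x] support_fun_hausdorff[OF B(1) A(2), of x]
          commute[of A B] A(2) B(1) by (simp add: Pkc_dist_def abs_le_iff)
      also have "\<dots> \<le> (1 + norm x) * Pkc_dist A B"
        by (intro mult_right_mono) auto
      also have "\<dots> < e" 
        using B(2) by (simp add: pos_less_divide_eq add_pos_nonneg mult.commute)
      finally show "B \<in> support_fun x -` S \<inter> Pkc"
        using e(2) B(1) by (auto simp: dist_real_def)
    qed
    then show "\<exists>r>0. mball A r \<subseteq> support_fun x -` S \<inter> Pkc"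
      using e(1) by (intro exI[of _ "e / (1 + norm x)"]) (simp add: add_pos_nonneg)
  qed simp
  then show "support_fun x -` S \<inter> space Pkc_borel \<in> sets Pkc_borel"
    by (simp add: Pkc_borel_def sets_measure_of[OF openin_Pkc_subset] 
        space_measure_of[OF openin_Pkc_subset] sigma_sets.Basic)
qed

section \<open>Finite-dimensional geometry\<close>

text \<open>Coefficients are functions on the whole type with the product topology. The value 0 off
  \<open>B\<close> makes the remaining factors singletons, so the box is a product of compact sets
  and Tychonoff applies.\<close>

lemma compact_coefficient_box:
  fixes B :: "'a set" and r :: real
  shows "compact {\<alpha> :: 'a \<Rightarrow> real. (\<forall>b\<in>B. \<bar>\<alpha> b\<bar> \<le> r) \<and> (\<forall>b. b \<notin> B \<longrightarrow> \<alpha> b = 0)}"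
proof -
  define J where "J b = (if b \<in> B then {- r..r} else {0})" for b :: 'a
  have "compactin (product_topology (\<lambda>_::'a. euclideanreal) UNIV) (PiE UNIV J)"
    by (simp add: compactin_PiE J_def)
  moreover have "PiE UNIV J = {\<alpha>. (\<forall>b\<in>B. \<bar>\<alpha> b\<bar> \<le> r) \<and> (\<forall>b. b \<notin> B \<longrightarrow> \<alpha> b = 0)}"
  proof (rule set_eqI)
    fix \<alpha> :: "'a \<Rightarrow> real"
    have "\<alpha> b \<in> J b \<longleftrightarrow> (b \<in> B \<longrightarrow> \<bar>\<alpha> b\<bar> \<le> r) \<and> (b \<notin> B \<longrightarrow> \<alpha> b = 0)" for b
      by (auto simp: J_def abs_le_iff)
    then show "\<alpha> \<in> PiE UNIV J \<longleftrightarrow>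
        \<alpha> \<in> {\<alpha>. (\<forall>b\<in>B. \<bar>\<alpha> b\<bar> \<le> r) \<and> (\<forall>b. b \<notin> B \<longrightarrow> \<alpha> b = 0)}"
      by (simp add: PiE_iff) blast
  qed
  ultimately show ?thesis by (simp add: euclidean_product_topology)
qed

text \<open>Equivalence of norms in finite dimension: on the compact l1 unit sphere of coefficients
  the norm of the combination attains its minimum, which independence makes positive; homogeneity
  does the rest.\<close>

lemma independent_norm_lower_bound:
  fixes B :: "'a::real_normed_vector set"
  assumes "finite B" "independent B"
  obtains c where "c > 0" "\<And>\<alpha>. c * (\<Sum>b\<in>B. \<bar>\<alpha> b\<bar>) \<le> norm (\<Sum>b\<in>B. \<alpha> b *\<^sub>R b)"
proof (cases "B = {}")
  case True
  then show ?thesis using that[of 1] by simp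
next
  case False
  define K where "K = {\<alpha> :: 'a \<Rightarrow> real. (\<forall>b\<in>B. \<bar>\<alpha> b\<bar> \<le> 1) \<and> (\<forall>b. b \<notin> B \<longrightarrow> \<alpha> b = 0)}
    \<inter> {\<alpha>. (\<Sum>b\<in>B. \<bar>\<alpha> b\<bar>) = 1}"
  have "compact K"
    unfolding K_def by (intro compact_Int_closed compact_coefficient_box closed_Collect_eq continuous_intros) auto
  obtain b0 where b0: "b0 \<in> B" using False by auto
  have "(\<lambda>b. if b = b0 then 1 else 0) \<in> K"
    using b0 \<open>finite B\<close> by (auto simp: K_def if_distrib[of abs] cong: if_cong)
  then have "K \<noteq> {}" by auto
  have "continuous_on K (\<lambda>\<alpha>. norm (\<Sum>b\<in>B. \<alpha> b *\<^sub>R b))"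
    by (intro continuous_intros continuous_on_subset[OF continuous_on_product_coordinates]) auto
  from continuous_attains_inf[OF \<open>compact K\<close> \<open>K \<noteq> {}\<close> this]
  obtain \<alpha>0 where \<alpha>0: "\<alpha>0 \<in> K"
    "\<And>\<alpha>. \<alpha> \<in> K \<Longrightarrow> norm (\<Sum>b\<in>B. \<alpha>0 b *\<^sub>R b) \<le> norm (\<Sum>b\<in>B. \<alpha> b *\<^sub>R b)" by blast
  define c where "c = norm (\<Sum>b\<in>B. \<alpha>0 b *\<^sub>R b)"
  have "c > 0"
  proof (rule ccontr)
    assume "\<not> c > 0"
    then have "(\<Sum>b\<in>B. \<alpha>0 b *\<^sub>R b) = 0" by (simp add: c_def)
    then have "\<forall>b\<in>B. \<alpha>0 b = 0"
      using assms independentD by blast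
    then show False using \<alpha>0(1) by (simp add: K_def)
  qed
  moreover have "c * (\<Sum>b\<in>B. \<bar>\<alpha> b\<bar>) \<le> norm (\<Sum>b\<in>B. \<alpha> b *\<^sub>R b)" for \<alpha>
  proof -
    define t where "t = (\<Sum>b\<in>B. \<bar>\<alpha> b\<bar>)"
    show ?thesis
    proof (cases "t = 0")
      case False
      then have "t > 0" by (simp add: t_def sum_nonneg order_le_neq_trans)
      have "\<bar>\<alpha> b\<bar> \<le> t" if "b \<in> B" for b
        unfolding t_def using that \<open>finite B\<close> by (intro member_le_sum) auto
      then have "(\<lambda>b. if b \<in> B then \<alpha> b / t else 0) \<in> K"
        using \<open>t > 0\<close> by (auto simp: K_def abs_divide t_def[symmetric] simp flip: sum_divide_distrib)
      from \<alpha>0(2)[OF this] have "c \<le> norm (\<Sum>b\<in>B. (\<alpha> b / t) *\<^sub>R b)"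
        by (simp add: c_def cong: sum.cong)
      also have "(\<Sum>b\<in>B. (\<alpha> b / t) *\<^sub>R b) = (1 / t) *\<^sub>R (\<Sum>b\<in>B. \<alpha> b *\<^sub>R b)"
        by (simp add: scaleR_sum_right)
      finally show ?thesis using \<open>t > 0\<close> by (simp add: t_def[symmetric] field_simps)
    qed (simp add: t_def)
  qed
  ultimately show ?thesis using that by blast
qed

text \<open>Stands in for the Euclidean structure that a finite-dimensional normed space does not carry
  by its type class.\<close>

locale coercive_inner =
  fixes ip :: "'a::real_normed_vector \<Rightarrow> 'a \<Rightarrow> real" and c :: real
  assumes bilinear: "bounded_bilinear ip"
    and commute: "ip v w = ip w v"
    and c_pos: "c > 0"
    and coercive: "c * (norm v)\<^sup>2 \<le> ip v v"
    and compact_cball: "compact (cball (0::'a) r)"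

text \<open>The product makes a basis orthonormal. Boundedness follows from the l1 lower bound on
  the norm, coercivity from Cauchy-Schwarz applied to the coordinate expansion.\<close>

lemma finite_span_coercive_inner:
  fixes B :: "'a::real_normed_vector set"
  assumes "finite B" "span B = UNIV"
  obtains ip :: "'a \<Rightarrow> 'a \<Rightarrow> real" and c where "coercive_inner ip c"
proof -
  obtain C where C: "C \<subseteq> B" "independent C" "B \<subseteq> span C"
    using maximal_independent_subset[of B] by blast
  have fin: "finite C" using C(1) assms(1) by (rule finite_subset)
  have span: "span C = UNIV"
    using span_mono[OF C(3)] assms(2) by (simp add: span_span top.extremum_uniqueI)
  define rep where "rep = representation C"
  have rep_sum: "(\<Sum>b\<in>C. rep v b *\<^sub>R b) = v" for v
    unfolding rep_def by (rule real_vector.sum_representation_eq) (use C fin span in auto)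
  have rep_add: "rep (v + w) b = rep v b + rep w b" for v w b
    unfolding rep_def using C(2) span by (simp add: real_vector.representation_add)
  have rep_scale: "rep (r *\<^sub>R v) b = r * rep v b" for r v b
    unfolding rep_def using C(2) span by (simp add: real_vector.representation_scale)
  have rep_zero: "rep v b = 0" if "b \<notin> C" for v b
    unfolding rep_def using that real_vector.representation_ne_zero by blast
  obtain d where d: "d > 0" "\<And>\<alpha>. d * (\<Sum>b\<in>C. \<bar>\<alpha> b\<bar>) \<le> norm (\<Sum>b\<in>C. \<alpha> b *\<^sub>R b)"
    using independent_norm_lower_bound[OF fin C(2)] by blast
  have rep_le: "\<bar>rep v b\<bar> \<le> norm v / d" if "b \<in> C" for v b
  proof -
    have "\<bar>rep v b\<bar> \<le> (\<Sum>b\<in>C. \<bar>rep v b\<bar>)"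
      using that fin by (intro member_le_sum) auto
    then show ?thesis
      using d(2)[of "rep v"] d(1) unfolding rep_sum
      by (smt (verit) mult.commute pos_le_divide_eq)
  qed
  define ip where "ip v w = (\<Sum>b\<in>C. rep v b * rep w b)" for v w
  \<comment> \<open>Cauchy-Schwarz bounds \<open>(norm v)\<^sup>2\<close> by \<open>ip v v\<close>
    times the sum; the added 1 keeps \<open>s\<close> positive when the basis is empty.\<close>
  define s where "s = 1 + (\<Sum>b\<in>C. (norm b)\<^sup>2)"
  have "s > 0" unfolding s_def by (intro add_pos_nonneg sum_nonneg) auto
  have "coercive_inner ip (1 / s)"
  proof
    show "ip (v + v') w = ip v w + ip v' w" "ip v (w + w') = ip v w + ip v w'"
      "ip (r *\<^sub>R v) w = r *\<^sub>R ip v w" "ip v (r *\<^sub>R w) = r *\<^sub>R ip v w" for v v' w w' r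
      by (simp_all add: ip_def rep_add rep_scale algebra_simps sum.distrib sum_distrib_left)
    have "norm (ip v w) \<le> norm v * norm w * (card C / d\<^sup>2)" for v w
    proof -
      have "norm (ip v w) \<le> (\<Sum>b\<in>C. (norm v / d) * (norm w / d))"
        unfolding ip_def
        by (intro order_trans[OF norm_sum] sum_mono) 
            (simp only: real_norm_def abs_mult, intro mult_mono rep_le, use d(1) in auto)
      then show ?thesis by (simp add: power2_eq_square field_simps)
    qed
    then show "\<exists>K. \<forall>v w. norm (ip v w) \<le> norm v * norm w * K" by blast
    show "ip v w = ip w v" for v w by (simp add: ip_def mult.commute)
    show "0 < 1 / s" using \<open>s > 0\<close> by simp
    show "1 / s * (norm v)\<^sup>2 \<le> ip v v" for v
    proof -
      have "norm v \<le> (\<Sum>b\<in>C. \<bar>rep v b\<bar> * norm b)"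
        using norm_sum[of "\<lambda>b. rep v b *\<^sub>R b" C] by (simp add: rep_sum)
      then have "(norm v)\<^sup>2 \<le> (\<Sum>b\<in>C. \<bar>rep v b\<bar> * norm b)\<^sup>2"
        by (rule power_mono) simp
      also have "\<dots> \<le> (\<Sum>b\<in>C. \<bar>rep v b\<bar>\<^sup>2) * (\<Sum>b\<in>C. (norm b)\<^sup>2)"
        by (rule Cauchy_Schwarz_ineq_sum)
      also have "\<dots> = ip v v * (\<Sum>b\<in>C. (norm b)\<^sup>2)"
        by (simp add: ip_def power2_eq_square)
      also have "\<dots> \<le> ip v v * s"
        by (intro mult_left_mono) (auto simp: s_def ip_def intro: sum_nonneg)
      finally show ?thesis using \<open>s > 0\<close> by (simp add: field_simps)
    qed
    show "compact (cball (0::'a) r)" for r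
    proof -
      \<comment> \<open>Heine-Borel: the ball is a closed part of the continuous image of a
        coefficient box.\<close>
      let ?K = "{\<alpha> :: 'a \<Rightarrow> real. (\<forall>b\<in>C. \<bar>\<alpha> b\<bar> \<le> r / d) \<and> (\<forall>b. b \<notin> C \<longrightarrow> \<alpha> b = 0)}"
      let ?f = "\<lambda>\<alpha>::'a \<Rightarrow> real. \<Sum>b\<in>C. \<alpha> b *\<^sub>R b"
      have compact_image: "compact (?f ` ?K)"
        by (intro compact_continuous_image compact_coefficient_box continuous_intros
            continuous_on_subset[OF continuous_on_product_coordinates]) auto
      have subset_image: "cball 0 r \<subseteq> ?f ` ?K"
      proof
        fix v :: 'a assume v: "v \<in> cball 0 r"
        have "\<bar>rep v b\<bar> \<le> r / d" if "b \<in> C" for b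
          using rep_le[OF that, of v] v d(1) by (simp add: order_trans[OF _ divide_right_mono])
        then have "rep v \<in> ?K" using rep_zero by auto
        then show "v \<in> ?f ` ?K" by (rule image_eqI[rotated]) (rule rep_sum[symmetric])
      qed
      show ?thesis
        using compact_Int_closed[OF compact_image closed_cball, of 0 r]
        unfolding Int_absorb1[OF subset_image] .
    qed
  qed
  then show ?thesis by (rule that)
qed

section \<open>From support functions to Hausdorff distance\<close>

context coercive_inner
begin

sublocale ip: bounded_bilinear ip by (rule bilinear)

text \<open>Functionals indexed by vectors in the manner of Riesz, so that nets and dense sets can
  be chosen in \<open>'a\<close>.\<close>

definition fnl :: "'a \<Rightarrow> 'a \<Rightarrow>\<^sub>L real" where
  "fnl v = Blinfun (ip v)"

lemma fnl_apply [simp]: "blinfun_apply (fnl v) = ip v"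
  unfolding fnl_def by (rule bounded_linear_Blinfun_apply) (rule ip.bounded_linear_right)

text \<open>Let \<open>p\<close> be a point of the closure of \<open>B\<close> nearest to
  \<open>a\<close> in the sense of \<open>ip\<close>. The direction \<open>v = a - p\<close>
  supports \<open>B\<close> at \<open>p\<close>, so for \<open>v\<close> nonzero the two support
  functions differ in that direction by at least \<open>ip v v / norm v\<close>, hence by
  \<open>c * norm v\<close>; this is where \<open>e / c\<close> comes from.\<close>

lemma infdist_le_if_support_le:
  assumes "B \<noteq> {}" "convex B" "bounded B" "bounded A" "a \<in> A" "0 \<le> e"
    and le: "\<And>u. norm u = 1 \<Longrightarrow> support_fun (fnl u) A \<le> support_fun (fnl u) B + e"
  shows "infdist a B \<le> e / c"
proof -
  obtain r where r: "B \<subseteq> cball 0 r"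
    using \<open>bounded B\<close> by (auto simp: bounded_iff subset_iff)
  have "compact (cball 0 r \<inter> closure B)"
    by (intro compact_Int_closed compact_cball) simp
  moreover have "closure B \<subseteq> cball 0 r"
    using r by (simp add: closure_minimal)
  ultimately have "compact (closure B)" by (simp add: Int_absorb1)
  moreover have "continuous_on (closure B) (\<lambda>x. ip (a - x) (a - x))"
    by (intro ip.continuous_on continuous_on_diff continuous_on_const continuous_on_id)
  moreover have "closure B \<noteq> {}" using \<open>B \<noteq> {}\<close> by simp
  ultimately obtain p where p: "p \<in> closure B"
    and min: "\<And>x. x \<in> closure B \<Longrightarrow> ip (a - p) (a - p) \<le> ip (a - x) (a - x)"
    using continuous_attains_inf[of "closure B" "\<lambda>x. ip (a - x) (a - x)"] by blast
  define v where "v = a - p"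
  \<comment> \<open>First-order optimality of \<open>p\<close>: the comparison with p + t(b - p) is
    divided by \<open>t\<close>, then \<open>t\<close> tends to 0 from the right.\<close>
  have var: "ip v (b - p) \<le> 0" if "b \<in> B" for b
  proof -
    define w where "w = b - p"
    have "2 * ip v w \<le> t * ip w w" if t: "0 < t" "t < 1" for t
    proof -
      have "(1 - t) *\<^sub>R p + t *\<^sub>R b \<in> closure B"
        using convex_closure[OF \<open>convex B\<close>] p \<open>b \<in> B\<close> closure_subset t
        by (intro convexD_alt) auto
      from min[OF this] have "ip v v \<le> ip (v - t *\<^sub>R w) (v - t *\<^sub>R w)"
        by (simp add: v_def w_def algebra_simps)
      also have "\<dots> = ip v v - t * (2 * ip v w) + t * (t * ip w w)"
        by (simp add: ip.diff_left ip.diff_right ip.scaleR_left ip.scaleR_right commute[of w v] algebra_simps)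
      finally have "t * (2 * ip v w) \<le> t * (t * ip w w)" by simp
      then show ?thesis using t by simp
    qed
    then have "eventually (\<lambda>t. 2 * ip v w \<le> t * ip w w) (at_right 0)"
      unfolding eventually_at_right_field by (metis zero_less_one)
    moreover have "((\<lambda>t. t * ip w w) \<longlongrightarrow> 0 * ip w w) (at_right 0)"
      by (intro tendsto_intros)
    ultimately have "2 * ip v w \<le> 0 * ip w w"
      by (intro tendsto_lowerbound) auto
    then show ?thesis by (simp add: w_def)
  qed
  have "norm v \<le> e / c"
  proof (cases "v = 0")
    case False
    \<comment> \<open>Normalised in the given norm and not in that of \<open>ip\<close>, because the
      hypothesis \<open>le\<close> speaks of \<open>norm u = 1\<close>.\<close>
    define u where "u = (1 / norm v) *\<^sub>R v"
    have u: "norm u = 1" using False by (simp add: u_def)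
    have "ip u b \<le> ip u p" if "b \<in> B" for b
      using var[OF that] False by (simp add: u_def ip.scaleR_left ip.diff_right divide_right_mono)
    then have "support_fun (fnl u) B \<le> ip u p"
      using \<open>B \<noteq> {}\<close> by (intro support_fun_least) auto
    moreover have "ip u a \<le> support_fun (fnl u) A"
      using support_fun_upper[OF \<open>bounded A\<close> \<open>a \<in> A\<close>, of "fnl u"] by simp
    ultimately have "ip u a - ip u p \<le> e" using le[OF u] by linarith
    moreover have "ip u a - ip u p = ip v v / norm v"
      by (simp add: u_def ip.scaleR_left v_def ip.diff_right)
        (simp add: diff_divide_distrib)
    moreover have "c * norm v \<le> ip v v / norm v"
      using coercive[of v] False by (simp add: field_simps power2_eq_square)
    ultimately show ?thesis using c_pos by (simp add: field_simps)
  qed (use \<open>0 \<le> e\<close> c_pos in auto)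
  moreover have "infdist a B \<le> infdist p B + dist a p"
    by (rule infdist_triangle)
  moreover have "infdist p B = 0"
    using p \<open>B \<noteq> {}\<close> by (simp add: in_closure_iff_infdist_zero)
  ultimately show ?thesis by (simp add: v_def dist_norm)
qed

text \<open>The net points are taken from the dense set and may lie off the sphere, so that a
  convergence known only on \<open>D\<close> applies to them.\<close>

lemma finite_net_unit_sphere:
  assumes dense: "\<And>U. open U \<Longrightarrow> U \<noteq> {} \<Longrightarrow> \<exists>w\<in>D. w \<in> U" and "\<delta> > 0"
  obtains F where "finite F" "F \<subseteq> D" "\<And>v::'a. norm v = 1 \<Longrightarrow> \<exists>w\<in>F. norm (v - w) < \<delta>"
proof -
  have "compact (cball 0 1 \<inter> sphere (0::'a) 1)"
    by (intro compact_Int_closed compact_cball)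
      (auto simp: sphere_def intro!: closed_Collect_eq continuous_intros)
  then have "compact (sphere (0::'a) 1)"
    by (simp add: Int_absorb1 sphere_cball)
  moreover have "sphere 0 1 \<subseteq> (\<Union>w\<in>D. ball w \<delta>)"
    using dense[OF open_ball, of _ \<delta>] \<open>\<delta> > 0\<close> by (fastforce simp: dist_commute)
  ultimately obtain F where "F \<subseteq> D" "finite F" "sphere 0 1 \<subseteq> (\<Union>w\<in>F. ball w \<delta>)"
    using compactE_image[of "sphere 0 1" D "\<lambda>w. ball w \<delta>"] open_ball by metis
  then show ?thesis
    by (intro that[of F]) (fastforce simp: dist_norm norm_minus_commute)+
qed

text \<open>As functions of the index vector the support functions of \<open>A n\<close> are
  Lipschitz with a constant proportional to the radius of \<open>A n\<close>. A common radius is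
  therefore needed before convergence on a finite net can be spread over the sphere.\<close>

theorem hausdorff_tendsto_0_if_support_tendsto:
  fixes A :: "nat \<Rightarrow> 'a set"
  assumes E: "E \<noteq> {}" "convex E" "bounded E"
    and A: "\<And>n. A n \<noteq> {}" "\<And>n. convex (A n)" "\<And>n. bounded (A n)"
    and dense: "\<And>U. open U \<Longrightarrow> U \<noteq> {} \<Longrightarrow> \<exists>w\<in>D. w \<in> U"
    and lim: "\<And>w. w \<in> D \<Longrightarrow> (\<lambda>n. support_fun (fnl w) (A n)) \<longlonglongrightarrow> support_fun (fnl w) E"
  shows "(\<lambda>n. hausdorff (A n) E) \<longlonglongrightarrow> 0"
proof -
  obtain K where K: "K > 0" "\<And>v w. norm (ip v w) \<le> norm v * norm w * K"
    using ip.pos_bounded by blast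
  have ip_diff: "ip v a \<le> ip w a + norm (v - w) * norm a * K" for v w a
    using K(2)[of "v - w" a] by (simp add: ip.diff_left)
  \<comment> \<open>Finitely many functionals suffice: moving from the direction of \<open>a\<close>
    to a net point closer than c/(2K) costs at most half of the coercive lower bound
    \<open>c * norm a\<close>, and the other half stays below the bounded sequence
    \<open>t\<close>.\<close>
  have "\<exists>R. \<forall>n. A n \<subseteq> cball 0 R"
  proof -
    have "c / (2 * K) > 0" using c_pos K(1) by simp
    from finite_net_unit_sphere[OF dense this] obtain F where
      F: "finite F" "F \<subseteq> D" "\<And>v. norm v = 1 \<Longrightarrow> \<exists>w\<in>F. norm (v - w) < c / (2 * K)" by blast
    define t where "t n = (\<Sum>w\<in>F. \<bar>support_fun (fnl w) (A n)\<bar>)" for n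
    have "t \<longlonglongrightarrow> (\<Sum>w\<in>F. \<bar>support_fun (fnl w) E\<bar>)"
      unfolding t_def using F(2) by (intro tendsto_intros lim) auto
    then have "Bseq t" by (intro convergent_imp_Bseq convergentI)
    then obtain T where T: "\<And>n. norm (t n) \<le> T" by (auto simp: Bseq_def)
    have "norm a \<le> 2 * T / c" if "a \<in> A n" for a n
    proof -
      have "c / 2 * norm a \<le> T"
      proof (cases "a = 0")
        case True
        then show ?thesis using order_trans[OF norm_ge_zero T] by simp
      next
        case False
        define v where "v = (1 / norm a) *\<^sub>R a"
        have "norm v = 1" using False by (simp add: v_def)
        from F(3)[OF this] obtain w where w: "w \<in> F" "norm (v - w) < c / (2 * K)" by blast
        have "c * norm a \<le> ip v a"
          using coercive[of a] False
          by (simp add: v_def ip.scaleR_left field_simps power2_eq_square)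
        also have "\<dots> \<le> ip w a + norm (v - w) * norm a * K" by (rule ip_diff)
        also have "ip w a \<le> support_fun (fnl w) (A n)"
          using support_fun_upper[OF A(3) that, of "fnl w"] by simp
        also have "\<dots> \<le> t n"
          unfolding t_def using F(1) w(1)
          by (intro order_trans[OF abs_ge_self member_le_sum[of w F "\<lambda>w. \<bar>support_fun (fnl w) (A n)\<bar>"]]) auto
        also have "t n \<le> T" using T[of n] by simp
        also have "norm (v - w) * norm a * K \<le> c / (2 * K) * norm a * K"
          using w(2) K(1) by (intro mult_right_mono) auto
        also have "\<dots> = c / 2 * norm a" using K(1) by simp
        finally show ?thesis by simp
      qed
      then show ?thesis using c_pos by (simp add: field_simps)
    qed
    then show ?thesis by (auto intro!: exI[of _ "2 * T / c"])
  qed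
  then obtain R1 where R1: "\<And>n. A n \<subseteq> cball 0 R1" by blast
  obtain R2 where R2: "E \<subseteq> cball 0 R2" using E(3) by (auto simp: bounded_iff subset_iff)
  \<comment> \<open>The 1 makes \<open>R\<close> positive for the division by \<open>R * K\<close>
    below.\<close>
  define R where "R = max 1 (max R1 R2)"
  have R: "R > 0" "\<And>n. \<forall>a\<in>A n. norm a \<le> R" "\<forall>a\<in>E. norm a \<le> R"
    using R1 R2 by (fastforce simp: R_def)+
  have lip: "support_fun (fnl v) X \<le> support_fun (fnl w) X + norm (v - w) * R * K"
    if X: "X \<noteq> {}" "bounded X" "\<forall>a\<in>X. norm a \<le> R" for X v w
  proof (rule support_fun_least[OF X(1)])
    fix a assume a: "a \<in> X"
    have "ip v a \<le> ip w a + norm (v - w) * norm a * K" by (rule ip_diff)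
    also have "norm (v - w) * norm a * K \<le> norm (v - w) * R * K"
      using K(1) bspec[OF X(3) a] by (intro mult_right_mono mult_left_mono) auto
    also have "ip w a \<le> support_fun (fnl w) X"
      using support_fun_upper[OF X(2) a, of "fnl w"] by simp
    finally show "blinfun_apply (fnl v) a \<le> support_fun (fnl w) X + norm (v - w) * R * K" by simp
  qed
  have ev: "eventually (\<lambda>n. hausdorff (A n) E \<le> \<epsilon>) sequentially" if "\<epsilon> > 0" for \<epsilon>
  proof -
    \<comment> \<open>Three errors of size \<open>\<eta>\<close>: the move to a net point for each
      of the two sets, and the convergence at that point. The factor \<open>c\<close> cancels the
      division by \<open>c\<close> in the separation estimate.\<close>
    define \<eta> where "\<eta> = \<epsilon> * c / 3"
    have "\<eta> > 0" using that c_pos by (simp add: \<eta>_def)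
    define \<delta> where "\<delta> = \<eta> / (R * K)"
    have "\<delta> > 0" using \<open>\<eta> > 0\<close> R(1) K(1) by (simp add: \<delta>_def)
    from finite_net_unit_sphere[OF dense this] obtain F where
      F: "finite F" "F \<subseteq> D" "\<And>v. norm v = 1 \<Longrightarrow> \<exists>w\<in>F. norm (v - w) < \<delta>" by blast
    have "eventually (\<lambda>n. \<forall>w\<in>F. dist (support_fun (fnl w) (A n)) (support_fun (fnl w) E) < \<eta>) sequentially"
    proof (intro eventually_ball_finite ballI F(1))
      fix w assume "w \<in> F"
      then have "w \<in> D" using F(2) by auto
      from tendstoD[OF lim[OF this] \<open>\<eta> > 0\<close>]
      show "eventually (\<lambda>n. dist (support_fun (fnl w) (A n)) (support_fun (fnl w) E) < \<eta>) sequentially" .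
    qed
    then show ?thesis
    proof eventually_elim
      fix n assume n: "\<forall>w\<in>F. dist (support_fun (fnl w) (A n)) (support_fun (fnl w) E) < \<eta>"
      have sup: "\<bar>support_fun (fnl v) (A n) - support_fun (fnl v) E\<bar> \<le> \<epsilon> * c" if v: "norm v = 1" for v
      proof -
        obtain w where w: "w \<in> F" "norm (v - w) < \<delta>" using F(3)[OF v] by blast
        have "norm (v - w) * R * K \<le> \<delta> * R * K"
          using w(2) R(1) K(1) by (intro mult_right_mono) auto
        also have "\<dots> = \<eta>" using R(1) K(1) by (simp add: \<delta>_def)
        finally have small: "norm (v - w) * R * K \<le> \<eta>" .
        have "\<bar>support_fun (fnl w) (A n) - support_fun (fnl w) E\<bar> < \<eta>"
          using n w(1) by (simp add: dist_real_def)
        moreover have "\<bar>support_fun (fnl v) X - support_fun (fnl w) X\<bar> \<le> \<eta>"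
          if "X \<noteq> {}" "bounded X" "\<forall>a\<in>X. norm a \<le> R" for X
          using lip[OF that, of v w] lip[OF that, of w v] small
          by (simp add: norm_minus_commute[of w v] abs_le_iff)
        from this[OF A(1,3) R(2)] this[OF E(1,3) R(3)]
        have "\<bar>support_fun (fnl v) (A n) - support_fun (fnl w) (A n)\<bar> \<le> \<eta>"
          "\<bar>support_fun (fnl v) E - support_fun (fnl w) E\<bar> \<le> \<eta>" .
        moreover have "\<epsilon> * c = 3 * \<eta>" by (simp add: \<eta>_def)
        ultimately show ?thesis by linarith
      qed
      have nn: "0 \<le> \<epsilon> * c" using that c_pos by simp
      have "infdist a E \<le> \<epsilon> * c / c" if "a \<in> A n" for a
      proof (rule infdist_le_if_support_le[OF E A(3) that nn])
        show "support_fun (fnl u) (A n) \<le> support_fun (fnl u) E + \<epsilon> * c" if "norm u = 1" for u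
          using sup[OF that] by linarith
      qed
      moreover have "infdist a (A n) \<le> \<epsilon> * c / c" if "a \<in> E" for a
      proof (rule infdist_le_if_support_le[OF A E(3) that nn])
        show "support_fun (fnl u) E \<le> support_fun (fnl u) (A n) + \<epsilon> * c" if "norm u = 1" for u
          using sup[OF that] by linarith
      qed
      ultimately show "hausdorff (A n) E \<le> \<epsilon>"
        using c_pos A E by (simp add: hausdorff_le_iff)
    qed
  qed
  have nn: "0 \<le> hausdorff (A n) E" for n
  proof -
    obtain a where "a \<in> A n" using A(1) by blast
    then have "infdist a E \<le> hausdorff (A n) E"
      using hausdorff_le_iff[OF A(1) E(1) A(3) E(3), of n "hausdorff (A n) E"] by auto
    then show ?thesis using infdist_nonneg[of a E] by linarith
  qed
  show ?thesis
  proof (rule tendstoI)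
    fix e :: real assume "e > 0"
    then show "eventually (\<lambda>n. dist (hausdorff (A n) E) 0 < e) sequentially"
      using ev[of "e / 2"] nn by (auto elim!: eventually_mono simp: dist_real_def)
  qed
qed

end

section \<open>Measurable selections and the Aumann expectation\<close>

text \<open>Kuratowski--Ryll-Nardzewski: the selection is the limit of functions with values in a
  countable dense set, the \<open>n\<close>-th being within \<open>(1/2) ^ n\<close> of \<open>F\<close>.\<close>

theorem measurable_selection:
  fixes F :: "'w \<Rightarrow> 'a::{complete_space, second_countable_topology} set"
  assumes ne: "\<And>\<omega>. \<omega> \<in> space M \<Longrightarrow> F \<omega> \<noteq> {}" and closed: "\<And>\<omega>. \<omega> \<in> space M \<Longrightarrow> closed (F \<omega>)"
    and meas: "\<And>U. open U \<Longrightarrow> {\<omega> \<in> space M. F \<omega> \<inter> U \<noteq> {}} \<in> sets M"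
  obtains f where "f \<in> borel_measurable M" "\<And>\<omega>. \<omega> \<in> space M \<Longrightarrow> f \<omega> \<in> F \<omega>"
proof -
  obtain D :: "'a set" where D: "countable D" "\<And>U. open U \<Longrightarrow> U \<noteq> {} \<Longrightarrow> \<exists>d\<in>D. d \<in> U"
    using countable_dense_setE by blast
  have "D \<noteq> {}" using D(2)[of UNIV] by auto
  define d where "d = from_nat_into D"
  have dense: "\<exists>i. y \<in> ball (d i) r" if "r > 0" for y r
  proof -
    obtain z where "z \<in> D" "z \<in> ball y r" using D(2)[of "ball y r"] \<open>r > 0\<close> by auto
    moreover have "range d = D"
      unfolding d_def using \<open>D \<noteq> {}\<close> D(1) by (rule range_from_nat_into)
    ultimately show ?thesis by (auto simp: dist_commute)
  qed
  \<comment> \<open>The next ball, of half the radius, must meet \<open>F\<close> inside the current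
    one; this keeps consecutive centres close.\<close>
  define hit where "hit i j n \<omega> \<longleftrightarrow> F \<omega> \<inter> (ball (d i) ((1/2) ^ Suc n) \<inter> ball (d j) ((1/2) ^ n)) \<noteq> {}"
    for i j n \<omega>
  \<comment> \<open>Taking the least admissible index makes each choice measurable, since it is
    settled by countably many hitting events.\<close>
  define k where "k = rec_nat (\<lambda>\<omega>. LEAST i. F \<omega> \<inter> ball (d i) 1 \<noteq> {})
    (\<lambda>n kn \<omega>. LEAST i. hit i (kn \<omega>) n \<omega>)"
  have k0: "k 0 = (\<lambda>\<omega>. LEAST i. F \<omega> \<inter> ball (d i) 1 \<noteq> {})"
    and kSuc: "k (Suc n) = (\<lambda>\<omega>. LEAST i. hit i (k n \<omega>) n \<omega>)" for n
    by (simp_all add: k_def)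
  have pred: "Measurable.pred M (\<lambda>\<omega>. F \<omega> \<inter> U \<noteq> {})" if "open U" for U
    using meas[OF that] by (simp add: pred_def)
  have k_meas: "k n \<in> measurable M (count_space UNIV)" for n
  proof (induction n)
    case 0
    show ?case unfolding k0 by (intro measurable_Least pred) simp
  next
    case (Suc n)
    have "Measurable.pred M (\<lambda>\<omega>. hit i j n \<omega>)" for i j
      unfolding hit_def by (intro pred) auto
    then have "Measurable.pred M (\<lambda>\<omega>. hit i (k n \<omega>) n \<omega>)" for i
      by (rule measurable_compose_countable[OF _ Suc])
    then show ?case unfolding kSuc by (rule measurable_Least)
  qed
  have near: "F \<omega> \<inter> ball (d (k n \<omega>)) ((1/2) ^ n) \<noteq> {}"
    and step: "hit (k (Suc n) \<omega>) (k n \<omega>) n \<omega>" if \<omega>: "\<omega> \<in> space M" for n \<omega>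
  proof -
    have "F \<omega> \<inter> ball (d (k n \<omega>)) ((1/2) ^ n) \<noteq> {} \<and> hit (k (Suc n) \<omega>) (k n \<omega>) n \<omega>"
    proof (induction n)
      case 0
      obtain y where "y \<in> F \<omega>" using ne[OF \<omega>] by blast
      then have "\<exists>i. F \<omega> \<inter> ball (d i) 1 \<noteq> {}" using dense[of 1 y] by fastforce
      then have 1: "F \<omega> \<inter> ball (d (k 0 \<omega>)) 1 \<noteq> {}" unfolding k0 by (rule LeastI_ex)
      then obtain z where "z \<in> F \<omega>" "z \<in> ball (d (k 0 \<omega>)) 1" by blast
      then have "\<exists>i. hit i (k 0 \<omega>) 0 \<omega>" using dense[of "(1/2) ^ Suc 0" z] unfolding hit_def by fastforce
      then have "hit (k (Suc 0) \<omega>) (k 0 \<omega>) 0 \<omega>" unfolding kSuc by (rule LeastI_ex)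
      with 1 show ?case by simp
    next
      case (Suc n)
      then obtain z where "z \<in> F \<omega>" "z \<in> ball (d (k (Suc n) \<omega>)) ((1/2) ^ Suc n)"
        unfolding hit_def by blast
      moreover from this have "\<exists>i. hit i (k (Suc n) \<omega>) (Suc n) \<omega>"
        using dense[of "(1/2) ^ Suc (Suc n)" z] unfolding hit_def by fastforce
      then have "hit (k (Suc (Suc n)) \<omega>) (k (Suc n) \<omega>) (Suc n) \<omega>"
        unfolding kSuc[of "Suc n"] by (rule LeastI_ex)
      ultimately show ?case by blast
    qed
    then show "F \<omega> \<inter> ball (d (k n \<omega>)) ((1/2) ^ n) \<noteq> {}" "hit (k (Suc n) \<omega>) (k n \<omega>) n \<omega>" by auto
  qed
  define g where "g n \<omega> = d (k n \<omega>)" for n \<omega>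
  have g_meas: "g n \<in> borel_measurable M" for n
    unfolding g_def by (rule measurable_compose[OF k_meas]) simp
  have g_step: "dist (g n \<omega>) (g (Suc n) \<omega>) \<le> 2 * (1/2) ^ n" if \<omega>: "\<omega> \<in> space M" for n \<omega>
  proof -
    obtain z where "dist (g (Suc n) \<omega>) z < (1/2) ^ Suc n" "dist (g n \<omega>) z < (1/2) ^ n"
      using step[OF \<omega>, of n] by (auto simp: hit_def g_def)
    then show ?thesis using dist_triangle2[of "g n \<omega>" "g (Suc n) \<omega>" z]
      by (simp add: dist_commute) (smt (verit) zero_le_power field_sum_of_halves)
  qed
  \<comment> \<open>The step bound 2 * (1/2)^n equals 4 * (1/2)^n - 4 * (1/2)^(n+1), so the steps
    telescope to this form.\<close>
  have g_dist: "dist (g n \<omega>) (g (n + j) \<omega>) \<le> 4 * (1/2) ^ n - 4 * (1/2) ^ (n + j)"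
    if \<omega>: "\<omega> \<in> space M" for n j \<omega>
  proof (induction j)
    case (Suc j)
    have "dist (g n \<omega>) (g (n + Suc j) \<omega>) \<le>
        dist (g n \<omega>) (g (n + j) \<omega>) + dist (g (n + j) \<omega>) (g (Suc (n + j)) \<omega>)"
      using dist_triangle by (simp only: add_Suc_right)
    also have "\<dots> \<le> 4 * (1/2) ^ n - 4 * (1/2) ^ (n + Suc j)"
      using Suc g_step[OF \<omega>, of "n + j"] by simp
    finally show ?case .
  qed simp
  have "Cauchy (\<lambda>n. g n \<omega>)" if \<omega>: "\<omega> \<in> space M" for \<omega>
  proof (rule metric_CauchyI)
    fix e :: real assume "e > 0"
    then obtain N where N: "(1/2) ^ N < e / 8"
      using real_arch_pow_inv[of "e / 8" "1/2"] by auto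
    have le: "dist (g N \<omega>) (g m \<omega>) < e / 2" if "m \<ge> N" for m
    proof -
      have "dist (g N \<omega>) (g m \<omega>) \<le> 4 * (1/2) ^ N - 4 * (1/2) ^ m"
        using g_dist[OF \<omega>, of N "m - N"] that by simp
      moreover have "0 < (1/2 :: real) ^ m" by simp
      ultimately show ?thesis using N by linarith
    qed
    have "dist (g m \<omega>) (g n \<omega>) < e" if "m \<ge> N" "n \<ge> N" for m n
      using dist_triangle_half_r[OF le[OF that(1)] le[OF that(2)]] .
    then show "\<exists>N. \<forall>m\<ge>N. \<forall>n\<ge>N. dist (g m \<omega>) (g n \<omega>) < e" by blast
  qed
  then have "\<exists>l. (\<lambda>n. g n \<omega>) \<longlonglongrightarrow> l" if "\<omega> \<in> space M" for \<omega>
    using that Cauchy_convergent convergent_def by blast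
  then obtain f where f: "\<And>\<omega>. \<omega> \<in> space M \<Longrightarrow> (\<lambda>n. g n \<omega>) \<longlonglongrightarrow> f \<omega>" by metis
  have "f \<omega> \<in> F \<omega>" if \<omega>: "\<omega> \<in> space M" for \<omega>
  proof -
    have "\<forall>n. \<exists>y. y \<in> F \<omega> \<and> dist (g n \<omega>) y < (1/2) ^ n"
    proof
      fix n
      obtain y where "y \<in> F \<omega> \<inter> ball (g n \<omega>) ((1/2) ^ n)"
        using near[OF \<omega>, of n] unfolding g_def by blast
      then show "\<exists>y. y \<in> F \<omega> \<and> dist (g n \<omega>) y < (1/2) ^ n" by auto
    qed
    then obtain y where y: "\<And>n. y n \<in> F \<omega>" "\<And>n. dist (g n \<omega>) (y n) < (1/2) ^ n" by metis
    have "(\<lambda>n. dist (g n \<omega>) (y n)) \<longlonglongrightarrow> 0"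
    proof (rule tendsto_sandwich[OF _ _ tendsto_const])
      show "(\<lambda>n. (1/2 :: real) ^ n) \<longlonglongrightarrow> 0" by (rule LIMSEQ_power_zero) simp
      show "eventually (\<lambda>n. dist (g n \<omega>) (y n) \<le> (1/2) ^ n) sequentially"
        using y(2) by (intro always_eventually allI less_imp_le)
    qed simp
    moreover have "(\<lambda>n. dist (g n \<omega>) (f \<omega>)) \<longlonglongrightarrow> 0"
      using f[OF \<omega>] by (simp add: tendsto_dist_iff[symmetric])
    ultimately have lim: "(\<lambda>n. dist (g n \<omega>) (y n) + dist (g n \<omega>) (f \<omega>)) \<longlonglongrightarrow> 0"
      using tendsto_add by fastforce
    have "(\<lambda>n. dist (y n) (f \<omega>)) \<longlonglongrightarrow> 0"
      by (rule tendsto_sandwich[OF _ _ tendsto_const lim])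
        (simp_all add: dist_triangle3 always_eventually)
    then have "y \<longlonglongrightarrow> f \<omega>" by (simp add: tendsto_dist_iff[symmetric])
    then show ?thesis using closed_sequentially[OF closed[OF \<omega>]] y(1) by blast
  qed
  moreover have "f \<in> borel_measurable M"
    by (rule borel_measurable_LIMSEQ_metric[OF g_meas f])
  ultimately show ?thesis using that by blast
qed

section \<open>Support function of the Aumann expectation\<close>

lemma norm_le_normP:
  assumes "A \<in> Pkc" "a \<in> A"
  shows "norm a \<le> normP A"
proof -
  note A = PkcD[OF assms(1)]
  have "bdd_above (norm ` A)"
    using A(4) by (simp add: bounded_imp_bdd_above bounded_norm_comp)
  then show ?thesis using A assms(2) by (simp add: normP_eq cSUP_upper)
qed

lemma abs_support_fun_le:
  assumes "A \<in> Pkc"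
  shows "\<bar>support_fun x A\<bar> \<le> norm x * normP A"
proof -
  note A = PkcD[OF assms]
  have le: "\<bar>blinfun_apply x a\<bar> \<le> norm x * normP A" if "a \<in> A" for a
  proof -
    have "\<bar>blinfun_apply x a\<bar> \<le> norm x * norm a" using norm_blinfun[of x a] by simp
    also have "\<dots> \<le> norm x * normP A"
      using norm_le_normP[OF assms that] by (intro mult_left_mono) auto
    finally show ?thesis .
  qed
  obtain a where "a \<in> A" using A(1) by blast
  then have "- (norm x * normP A) \<le> support_fun x A"
    using le[of a] support_fun_upper[OF A(4), of a x] by linarith
  moreover have "support_fun x A \<le> norm x * normP A"
    using A(1) le by (intro support_fun_least) (auto simp: abs_le_iff)
  ultimately show ?thesis by (simp add: abs_le_iff)
qed

lemma support_fun_measurable: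
  fixes F :: "'w \<Rightarrow> 'a::{real_normed_vector, second_countable_topology} set"
  assumes "Pkc_valued_rv M F"
  shows "(\<lambda>\<omega>. support_fun x (F \<omega>)) \<in> borel_measurable M"
  by (rule measurable_compose[OF Pkc_valued_rv_measurable[OF assms] support_fun_borel_measurable])

text \<open>The strict inequality in \<open>G\<close> writes hitting events as countable unions over
  rational thresholds. Since \<open>G\<close> need not be closed, the selection is taken in its
  closure, which meets the same open sets and only weakens the inequality.\<close>

lemma near_maximal_selection:
  fixes F :: "'w \<Rightarrow> 'a::{banach, second_countable_topology} set"
  assumes F: "Pkc_valued_rv M F" and e: "e > 0"
  obtains f where "f \<in> borel_measurable M"
    "\<And>\<omega>. \<omega> \<in> space M \<Longrightarrow> f \<omega> \<in> F \<omega>"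
    "\<And>\<omega>. \<omega> \<in> space M \<Longrightarrow> support_fun x (F \<omega>) - e \<le> blinfun_apply x (f \<omega>)"
proof -
  have Pkc: "F \<omega> \<in> Pkc" if "\<omega> \<in> space M" for \<omega> using F that by (simp add: Pkc_valued_rv_def)
  have hit: "{\<omega> \<in> space M. F \<omega> \<inter> U \<noteq> {}} \<in> sets M" if "open U" for U
    using F that by (simp add: Pkc_valued_rv_def set_valued_rv_def)
  note [measurable] = support_fun_measurable[OF F, of x]
  define G where "G \<omega> = {v \<in> F \<omega>. support_fun x (F \<omega>) - e < blinfun_apply x v}" for \<omega>
  have ne: "closure (G \<omega>) \<noteq> {}" if \<omega>: "\<omega> \<in> space M" for \<omega>
  proof
    assume "closure (G \<omega>) = {}"
    then have "\<forall>v\<in>F \<omega>. blinfun_apply x v \<le> support_fun x (F \<omega>) - e"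
      by (auto simp: G_def not_less)
    then have "support_fun x (F \<omega>) \<le> support_fun x (F \<omega>) - e"
      using PkcD(1)[OF Pkc[OF \<omega>]] by (intro support_fun_least) auto
    then show False using e by simp
  qed
  have hit_closure: "{\<omega> \<in> space M. closure (G \<omega>) \<inter> U \<noteq> {}} \<in> sets M" if "open U" for U
  proof -
    \<comment> \<open>A rational \<open>q\<close> between the two sides decouples the random
      threshold from the condition on \<open>v\<close>.\<close>
    have "{\<omega> \<in> space M. closure (G \<omega>) \<inter> U \<noteq> {}} =
        (\<Union>q\<in>\<rat>. {\<omega> \<in> space M. support_fun x (F \<omega>) - e < q} \<inter>
          {\<omega> \<in> space M. F \<omega> \<inter> (U \<inter> {v. q < blinfun_apply x v}) \<noteq> {}})" (is "?L = ?R")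
    proof (intro equalityI subsetI)
      fix \<omega> assume "\<omega> \<in> ?L"
      then have \<omega>: "\<omega> \<in> space M" "U \<inter> G \<omega> \<noteq> {}"
        using open_Int_closure_eq_empty[OF \<open>open U\<close>, of "G \<omega>"] by (auto simp: Int_commute)
      then obtain v where v: "v \<in> U" "v \<in> F \<omega>" "support_fun x (F \<omega>) - e < blinfun_apply x v"
        by (auto simp: G_def)
      obtain q where "q \<in> \<rat>" "support_fun x (F \<omega>) - e < q" "q < blinfun_apply x v"
        using Rats_dense_in_real[OF v(3)] by blast
      then show "\<omega> \<in> ?R" using \<omega>(1) v(1,2) by blast
    next
      fix \<omega> assume "\<omega> \<in> ?R"
      then obtain q v where v: "\<omega> \<in> space M" "support_fun x (F \<omega>) - e < q" "v \<in> F \<omega>" "v \<in> U"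
        "q < blinfun_apply x v" by blast
      then have "v \<in> G \<omega>" by (simp add: G_def)
      then show "\<omega> \<in> ?L" using v(1,4) closure_subset by blast
    qed
    also have "\<dots> \<in> sets M"
    proof (intro sets.countable_UN'' countable_rat sets.Int)
      show "{\<omega> \<in> space M. support_fun x (F \<omega>) - e < q} \<in> sets M" for q by measurable
      have "open {v. q < blinfun_apply x v}" for q
        by (intro open_Collect_less continuous_intros)
      then show "{\<omega> \<in> space M. F \<omega> \<inter> (U \<inter> {v. q < blinfun_apply x v}) \<noteq> {}} \<in> sets M" for q
        using \<open>open U\<close> by (intro hit open_Int)
    qed
    finally show ?thesis .
  qed
  obtain f where f: "f \<in> borel_measurable M"
    "\<And>\<omega>. \<omega> \<in> space M \<Longrightarrow> f \<omega> \<in> closure (G \<omega>)"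
    using measurable_selection[of M "\<lambda>\<omega>. closure (G \<omega>)", OF ne _ hit_closure] closed_closure
    by blast
  have "closure (G \<omega>) \<subseteq> F \<omega> \<inter> {v. support_fun x (F \<omega>) - e \<le> blinfun_apply x v}"
    if "\<omega> \<in> space M" for \<omega>
    using PkcD(5)[OF Pkc[OF that]]
    by (intro closure_minimal closed_Int closed_Collect_le continuous_intros) (auto simp: G_def)
  then have "f \<omega> \<in> F \<omega>" "support_fun x (F \<omega>) - e \<le> blinfun_apply x (f \<omega>)" if "\<omega> \<in> space M" for \<omega>
    using f(2) that by blast+
  then show ?thesis using that[of f] f(1) by blast
qed

context
  fixes M :: "'w measure" and F :: "'w \<Rightarrow> 'a::{banach, second_countable_topology} set"
  assumes F: "Pkc_valued_rv M F" and int: "integrable M (\<lambda>\<omega>. normP (F \<omega>))"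
begin

lemma selection_norm_le:
  assumes "AE \<omega> in M. f \<omega> \<in> F \<omega>"
  shows "AE \<omega> in M. norm (f \<omega>) \<le> normP (F \<omega>)"
  using assms AE_space
  by eventually_elim (use F in \<open>auto simp: Pkc_valued_rv_def intro: norm_le_normP\<close>)

lemma selection_integrable:
  assumes "f \<in> borel_measurable M" "AE \<omega> in M. f \<omega> \<in> F \<omega>"
  shows "integrable M f"
proof (rule Bochner_Integration.integrable_bound[OF int assms(1)])
  show "AE \<omega> in M. norm (f \<omega>) \<le> norm (normP (F \<omega>))"
    using selection_norm_le[OF assms(2)] by eventually_elim simp
qed

lemma support_fun_integrable: "integrable M (\<lambda>\<omega>. support_fun x (F \<omega>))"
proof (rule Bochner_Integration.integrable_bound)
  show "integrable M (\<lambda>\<omega>. norm x * normP (F \<omega>))" using int by simp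
  show "(\<lambda>\<omega>. support_fun x (F \<omega>)) \<in> borel_measurable M" by (rule support_fun_measurable[OF F])
  show "AE \<omega> in M. norm (support_fun x (F \<omega>)) \<le> norm (norm x * normP (F \<omega>))"
  proof (rule AE_I2)
    fix \<omega> assume "\<omega> \<in> space M"
    then have "F \<omega> \<in> Pkc" using F by (simp add: Pkc_valued_rv_def)
    from order_trans[OF abs_support_fun_le[OF this] abs_ge_self]
    show "norm (support_fun x (F \<omega>)) \<le> norm (norm x * normP (F \<omega>))" by simp
  qed
qed

lemma aumann_expectation_nonempty: "aumann_expectation M F \<noteq> {}"
proof -
  obtain f where "f \<in> borel_measurable M" "\<And>\<omega>. \<omega> \<in> space M \<Longrightarrow> f \<omega> \<in> F \<omega>"
    using near_maximal_selection[OF F zero_less_one] by blast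
  then show ?thesis
    using selection_integrable[of f] unfolding aumann_expectation_def by blast
qed

lemma aumann_expectation_bounded: "bounded (aumann_expectation M F)"
proof (rule boundedI)
  fix a assume "a \<in> aumann_expectation M F"
  then obtain f where f: "a = integral\<^sup>L M f" "integrable M f" "AE \<omega> in M. f \<omega> \<in> F \<omega>"
    by (auto simp: aumann_expectation_def)
  have "norm a \<le> (\<integral>\<omega>. norm (f \<omega>) \<partial>M)"
    unfolding f(1) by (rule Bochner_Integration.integral_norm_bound)
  also have "\<dots> \<le> (\<integral>\<omega>. normP (F \<omega>) \<partial>M)"
    by (rule integral_mono_AE[OF integrable_norm[OF f(2)] int selection_norm_le[OF f(3)]])
  finally show "norm a \<le> (\<integral>\<omega>. normP (F \<omega>) \<partial>M)" .
qed

lemma aumann_expectation_convex: "convex (aumann_expectation M F)"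
proof (rule convexI)
  fix a b and u v :: real
  assume "a \<in> aumann_expectation M F" "b \<in> aumann_expectation M F" and uv: "0 \<le> u" "0 \<le> v" "u + v = 1"
  then obtain f g where f: "a = integral\<^sup>L M f" "integrable M f" "AE \<omega> in M. f \<omega> \<in> F \<omega>"
    and g: "b = integral\<^sup>L M g" "integrable M g" "AE \<omega> in M. g \<omega> \<in> F \<omega>"
    by (auto simp: aumann_expectation_def)
  have "AE \<omega> in M. u *\<^sub>R f \<omega> + v *\<^sub>R g \<omega> \<in> F \<omega>"
    using f(3) g(3) AE_space
    by eventually_elim (use F uv PkcD(3) in \<open>auto simp: Pkc_valued_rv_def intro: convexD\<close>)
  moreover have "u *\<^sub>R a + v *\<^sub>R b = (\<integral>\<omega>. u *\<^sub>R f \<omega> + v *\<^sub>R g \<omega> \<partial>M)"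
    unfolding f(1) g(1) using f(2) g(2) by simp
  ultimately show "u *\<^sub>R a + v *\<^sub>R b \<in> aumann_expectation M F"
    unfolding aumann_expectation_def using f(2) g(2)
    by (intro CollectI exI[of _ "\<lambda>\<omega>. u *\<^sub>R f \<omega> + v *\<^sub>R g \<omega>"]) auto
qed

text \<open>One inequality is monotonicity of the integral for each selection. The other uses a
  selection maximal up to \<open>e\<close>, a loss that integrates to exactly \<open>e\<close> over
  a probability space.\<close>

theorem support_fun_aumann_expectation:
  assumes "prob_space M"
  shows "support_fun x (aumann_expectation M F) = (\<integral>\<omega>. support_fun x (F \<omega>) \<partial>M)"
proof (rule antisym)
  interpret prob_space M by fact
  note bl = blinfun.bounded_linear_right[of x]
  show "support_fun x (aumann_expectation M F) \<le> (\<integral>\<omega>. support_fun x (F \<omega>) \<partial>M)"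
  proof (rule support_fun_least[OF aumann_expectation_nonempty])
    fix a assume "a \<in> aumann_expectation M F"
    then obtain f where f: "a = integral\<^sup>L M f" "integrable M f" "AE \<omega> in M. f \<omega> \<in> F \<omega>"
      by (auto simp: aumann_expectation_def)
    have "blinfun_apply x a = (\<integral>\<omega>. blinfun_apply x (f \<omega>) \<partial>M)"
      unfolding f(1) using integral_bounded_linear[OF bl f(2)] by simp
    also have "\<dots> \<le> (\<integral>\<omega>. support_fun x (F \<omega>) \<partial>M)"
    proof (rule integral_mono_AE[OF integrable_bounded_linear[OF bl f(2)] support_fun_integrable])
      show "AE \<omega> in M. blinfun_apply x (f \<omega>) \<le> support_fun x (F \<omega>)"
        using f(3) AE_space
        by eventually_elim (use F in \<open>auto simp: Pkc_valued_rv_def intro: support_fun_upper PkcD(4)\<close>)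
    qed
    finally show "blinfun_apply x a \<le> (\<integral>\<omega>. support_fun x (F \<omega>) \<partial>M)" .
  qed
  show "(\<integral>\<omega>. support_fun x (F \<omega>) \<partial>M) \<le> support_fun x (aumann_expectation M F)"
  proof (rule field_le_epsilon)
    fix e :: real assume "e > 0"
    obtain f where f: "f \<in> borel_measurable M" "\<And>\<omega>. \<omega> \<in> space M \<Longrightarrow> f \<omega> \<in> F \<omega>"
      "\<And>\<omega>. \<omega> \<in> space M \<Longrightarrow> support_fun x (F \<omega>) - e \<le> blinfun_apply x (f \<omega>)"
      using near_maximal_selection[OF F \<open>e > 0\<close>, of x] by blast
    have fi: "integrable M f" using f by (intro selection_integrable) auto
    have "(\<integral>\<omega>. support_fun x (F \<omega>) \<partial>M) - e = (\<integral>\<omega>. support_fun x (F \<omega>) - e \<partial>M)"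
      using support_fun_integrable[of x] by (simp add: prob_space)
    also have "\<dots> \<le> (\<integral>\<omega>. blinfun_apply x (f \<omega>) \<partial>M)"
      using f(3) support_fun_integrable[of x] integrable_bounded_linear[OF bl fi]
      by (intro integral_mono) auto
    also have "\<dots> = blinfun_apply x (integral\<^sup>L M f)"
      using integral_bounded_linear[OF bl fi] by simp
    also have "\<dots> \<le> support_fun x (aumann_expectation M F)"
      using fi f(2) by (intro support_fun_upper aumann_expectation_bounded)
        (auto simp: aumann_expectation_def)
    finally show "(\<integral>\<omega>. support_fun x (F \<omega>) \<partial>M) \<le> support_fun x (aumann_expectation M F) + e" by simp
  qed
qed

end

section \<open>Minkowski averages\<close>

lemma bounded_set_plus:
  fixes A B :: "'a::real_normed_vector set"
  assumes "bounded A" "bounded B"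
  shows "bounded (A + B)"
  using bounded_plus[OF assms] by (simp add: set_plus_image)

lemma support_fun_set_plus:
  fixes A B :: "'a::real_normed_vector set"
  assumes "A \<noteq> {}" "B \<noteq> {}" "bounded A" "bounded B"
  shows "support_fun x (A + B) = support_fun x A + support_fun x B"
proof (rule antisym)
  show "support_fun x (A + B) \<le> support_fun x A + support_fun x B"
  proof (rule support_fun_least)
    show "A + B \<noteq> {}" using assms by (auto simp: set_plus_def)
    fix c assume "c \<in> A + B"
    then obtain a b where "c = a + b" "a \<in> A" "b \<in> B" by (rule set_plus_elim)
    then show "blinfun_apply x c \<le> support_fun x A + support_fun x B"
      using assms by (simp add: blinfun.add_right add_mono support_fun_upper)
  qed
  have "support_fun x B \<le> support_fun x (A + B) - blinfun_apply x a" if a: "a \<in> A" for a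
  proof (rule support_fun_least[OF assms(2)])
    fix b assume "b \<in> B"
    then have "blinfun_apply x (a + b) \<le> support_fun x (A + B)"
      using a assms by (intro support_fun_upper bounded_set_plus set_plus_intro)
    then show "blinfun_apply x b \<le> support_fun x (A + B) - blinfun_apply x a"
      by (simp add: blinfun.add_right)
  qed
  then have "support_fun x A \<le> support_fun x (A + B) - support_fun x B"
    using assms(1) by (intro support_fun_least) (auto simp: algebra_simps)
  then show "support_fun x A + support_fun x B \<le> support_fun x (A + B)" by simp
qed

text \<open>The claims are proved jointly because additivity of the support function at each step
  needs the partial sum to be nonempty and bounded.\<close>

lemma Minkowski_sum_support_fun:
  fixes A :: "'i \<Rightarrow> 'a::real_normed_vector set"
  assumes "finite I" "\<And>i. i \<in> I \<Longrightarrow> A i \<in> Pkc"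
  shows "sum A I \<noteq> {} \<and> convex (sum A I) \<and> bounded (sum A I) \<and>
    support_fun x (sum A I) = (\<Sum>i\<in>I. support_fun x (A i))"
  using assms
proof (induction I rule: finite_induct)
  case empty
  show ?case by (simp add: set_zero support_fun_def)
next
  case (insert i I)
  then show ?case
    using PkcD[of "A i"]
    by (auto simp: convex_set_plus bounded_set_plus support_fun_set_plus)
qed

lemma support_fun_scaleR:
  assumes "A \<noteq> {}" "bounded A" "0 \<le> t"
  shows "support_fun x ((*\<^sub>R) t ` A) = t * support_fun x A"
\<comment> \<open>This case occurs for the averages at \<open>n = 0\<close>, where
  \<open>1 / real 0 = 0\<close>.\<close>
proof (cases "t = 0")
  case True
  then show ?thesis using assms(1) by (simp add: support_fun_def image_constant_conv)
next
  case False
  then have t: "t > 0" using assms(3) by simp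
  show ?thesis
  proof (rule antisym)
    show "support_fun x ((*\<^sub>R) t ` A) \<le> t * support_fun x A"
      using assms support_fun_upper[OF assms(2)]
      by (intro support_fun_least) (auto simp: blinfun.scaleR_right mult_left_mono)
    have "blinfun_apply x a \<le> support_fun x ((*\<^sub>R) t ` A) / t" if "a \<in> A" for a
      using support_fun_upper[OF bounded_scaling[OF assms(2)], of "t *\<^sub>R a" t x] that t
      by (simp add: blinfun.scaleR_right field_simps)
    then have "support_fun x A \<le> support_fun x ((*\<^sub>R) t ` A) / t"
      by (rule support_fun_least[OF assms(1)])
    then show "t * support_fun x A \<le> support_fun x ((*\<^sub>R) t ` A)"
      using t by (simp add: field_simps)
  qed
qed

text \<open>Equal laws give the variables \<open>support_fun x (V k \<omega>)\<close> a common mean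
  and variance, so after centring they are orthogonal with the same second moment.\<close>

lemma strong_law_support_fun:
  fixes V :: "nat \<Rightarrow> 'w \<Rightarrow> 'a::{banach, second_countable_topology} set"
  assumes "prob_space M"
    and V: "\<And>n. n \<ge> 1 \<Longrightarrow> Pkc_valued_rv M (V n)"
    and unc: "set_uncorrelated M {1..} V"
    and iid: "identically_distributed M {1..} V"
    and sq: "integrable M (\<lambda>\<omega>. (normP (V 1 \<omega>))\<^sup>2)"
  shows "AE \<omega> in M. (\<lambda>n. (\<Sum>k\<in>{1..n}. support_fun x (V k \<omega>)) / real n)
    \<longlonglongrightarrow> (\<integral>\<omega>. support_fun x (V 1 \<omega>) \<partial>M)"
proof -
  interpret prob_space M by fact
  define X where "X k \<omega> = support_fun x (V k \<omega>)" for k \<omega>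
  define m where "m = integral\<^sup>L M (X 1)"
  have uncX: "uncorrelated M (X i) (X j)" if "i \<ge> 1" "j \<ge> 1" "i \<noteq> j" for i j
    using unc that unfolding set_uncorrelated_def X_def by auto
  \<comment> \<open>Integrability is part of \<open>uncorrelated\<close>; \<open>Suc k\<close>
    serves as an index different from \<open>k\<close>.\<close>
  have X_int: "integrable M (X k)" if "k \<ge> 1" for k
    using uncX[of k "Suc k"] that by (simp add: uncorrelated_def)
  have law: "distr M Pkc_borel (V k) = distr M Pkc_borel (V 1)" if "k \<ge> 1" for k
    using bspec[OF bspec[OF iid[unfolded identically_distributed_def], of k], of 1] that by simp
  \<comment> \<open>Both sides are integrals of \<open>g\<close> against the common law; the change
    of variables rests on measurability into \<open>Pkc_borel\<close>.\<close>
  have same: "integrable M (\<lambda>\<omega>. g (V k \<omega>)) \<longleftrightarrow> integrable M (\<lambda>\<omega>. g (V 1 \<omega>))"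
      "(\<integral>\<omega>. g (V k \<omega>) \<partial>M) = (\<integral>\<omega>. g (V 1 \<omega>) \<partial>M)"
    if "k \<ge> 1" and g: "g \<in> borel_measurable Pkc_borel" for k and g :: "'a set \<Rightarrow> real"
    using integrable_distr_eq[OF Pkc_valued_rv_measurable[OF V[OF \<open>k \<ge> 1\<close>]] g]
      integrable_distr_eq[OF Pkc_valued_rv_measurable[OF V[OF order_refl]] g]
      integral_distr[OF Pkc_valued_rv_measurable[OF V[OF \<open>k \<ge> 1\<close>]] g]
      integral_distr[OF Pkc_valued_rv_measurable[OF V[OF order_refl]] g]
      law[OF \<open>k \<ge> 1\<close>] by simp_all
  have mean: "integral\<^sup>L M (X k) = m" if "k \<ge> 1" for k
    using same(2)[OF that, of "support_fun x"] by (simp add: X_def[abs_def] m_def)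
  define Y where "Y k \<omega> = X k \<omega> - m" for k \<omega>
  have "integrable M (\<lambda>\<omega>. (X 1 \<omega>)\<^sup>2)"
  proof (rule Bochner_Integration.integrable_bound)
    show "integrable M (\<lambda>\<omega>. (norm x)\<^sup>2 * (normP (V 1 \<omega>))\<^sup>2)" using sq by simp
    show "(\<lambda>\<omega>. (X 1 \<omega>)\<^sup>2) \<in> borel_measurable M"
      using X_int[of 1] by (intro borel_measurable_power) auto
    show "AE \<omega> in M. norm ((X 1 \<omega>)\<^sup>2) \<le> norm ((norm x)\<^sup>2 * (normP (V 1 \<omega>))\<^sup>2)"
    proof (rule AE_I2)
      fix \<omega> assume "\<omega> \<in> space M"
      then have "\<bar>X 1 \<omega>\<bar> \<le> norm x * normP (V 1 \<omega>)"
        using V[of 1] by (simp add: X_def abs_support_fun_le Pkc_valued_rv_def)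
      then have "\<bar>X 1 \<omega>\<bar>\<^sup>2 \<le> (norm x * normP (V 1 \<omega>))\<^sup>2" by (rule power_mono) simp
      then show "norm ((X 1 \<omega>)\<^sup>2) \<le> norm ((norm x)\<^sup>2 * (normP (V 1 \<omega>))\<^sup>2)"
        by (simp add: power_mult_distrib)
    qed
  qed
  then have "integrable M (\<lambda>\<omega>. (X 1 \<omega>)\<^sup>2 - 2 * m * X 1 \<omega> + m\<^sup>2)"
    using X_int[of 1] by simp
  then have Y1: "integrable M (\<lambda>\<omega>. Y 1 \<omega> * Y 1 \<omega>)"
    by (simp add: Y_def power2_eq_square algebra_simps)
  have sqY: "integrable M (\<lambda>\<omega>. Y k \<omega> * Y k \<omega>)"
      "(\<integral>\<omega>. Y k \<omega> * Y k \<omega> \<partial>M) = (\<integral>\<omega>. Y 1 \<omega> * Y 1 \<omega> \<partial>M)" if "k \<ge> 1" for k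
    using same[OF that, of "\<lambda>A. (support_fun x A - m) * (support_fun x A - m)"] Y1
    by (simp_all add: Y_def X_def)
  have Yint: "integrable M (\<lambda>\<omega>. Y i \<omega> * Y j \<omega>)" if "i \<ge> 1" "j \<ge> 1" for i j
  proof (cases "i = j")
    case False
    have "integrable M (\<lambda>\<omega>. X i \<omega> * X j \<omega> - m * X i \<omega> - m * X j \<omega> + m * m)"
      using uncX[OF that False] by (simp add: uncorrelated_def)
    then show ?thesis by (simp add: Y_def algebra_simps)
  qed (use sqY that in simp)
  have Yorth: "(\<integral>\<omega>. Y i \<omega> * Y j \<omega> \<partial>M) = 0" if "i \<ge> 1" "j \<ge> 1" "i \<noteq> j" for i j
    using uncX[OF that] mean that by (simp add: uncorrelated_def cov_def Y_def)
  have "AE \<omega> in M. (\<lambda>n. (\<Sum>k\<in>{1..n}. Y k \<omega>) / real n) \<longlonglongrightarrow> 0"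
    by (rule strong_law_orthogonal[OF Yint Yorth eq_refl[OF sqY(2)]])
  then show ?thesis
  proof eventually_elim
    fix \<omega> assume "(\<lambda>n. (\<Sum>k\<in>{1..n}. Y k \<omega>) / real n) \<longlonglongrightarrow> 0"
    then have "(\<lambda>n. (\<Sum>k\<in>{1..n}. Y k \<omega>) / real n + m) \<longlonglongrightarrow> 0 + m"
      by (intro tendsto_intros)
    \<comment> \<open>At \<open>n = 0\<close> both quotients are 0 by convention and the identity
      would force \<open>m = 0\<close>.\<close>
    moreover have "eventually (\<lambda>n. (\<Sum>k\<in>{1..n}. Y k \<omega>) / real n + m =
        (\<Sum>k\<in>{1..n}. X k \<omega>) / real n) sequentially"
      using eventually_ge_at_top[of 1]
      by eventually_elim (simp add: Y_def sum_subtractf field_simps)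
    ultimately show "(\<lambda>n. (\<Sum>k\<in>{1..n}. support_fun x (V k \<omega>)) / real n)
        \<longlonglongrightarrow> (\<integral>\<omega>. support_fun x (V 1 \<omega>) \<partial>M)"
      using Lim_transform_eventually by (fastforce simp: X_def[abs_def] m_def)
  qed
qed

theorem theorem4p4:
  fixes M :: "'w measure"
    and V :: "nat \<Rightarrow> 'w \<Rightarrow> 'a::{banach, second_countable_topology} set"
  assumes "prob_space M" and "complete_measure M" and "nonatomic M"
    and "\<exists>B :: 'a set. finite B \<and> span B = UNIV"
    and "\<forall>n\<ge>1. Pkc_valued_rv M (V n)"
    and "set_uncorrelated M {1..} V"
    and "identically_distributed M {1..} V"
    and "integrable M (\<lambda>\<omega>. normP (V 1 \<omega>))"
    and "integrable M (\<lambda>\<omega>. (normP (V 1 \<omega>) - integral\<^sup>L M (\<lambda>\<omega>. normP (V 1 \<omega>)))\<^sup>2)"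
  shows "AE \<omega> in M.
    (\<lambda>n. hausdorff ((*\<^sub>R) (1 / real n) ` (\<Sum>k\<in>{1..n}. V k \<omega>)) (aumann_expectation M (V 1)))
      \<longlonglongrightarrow> 0"
proof -
  interpret prob_space M by fact
  obtain ip :: "'a \<Rightarrow> 'a \<Rightarrow> real" and c where "coercive_inner ip c"
    using assms(4) finite_span_coercive_inner by blast
  then interpret coercive_inner ip c .
  have V: "Pkc_valued_rv M (V n)" if "n \<ge> 1" for n using assms(5) that by simp
  have V_Pkc: "V n \<omega> \<in> Pkc" if "n \<ge> 1" "\<omega> \<in> space M" for n \<omega>
    using V[OF that(1)] that(2) by (simp add: Pkc_valued_rv_def)
  note V1 = V[OF order_refl] assms(8)
  define m where "m = (\<integral>\<omega>. normP (V 1 \<omega>) \<partial>M)"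
  \<comment> \<open>Finite variance becomes a finite second moment through r^2 = (r - m)^2 + 2mr -
    m^2.\<close>
  have "integrable M (\<lambda>\<omega>. (normP (V 1 \<omega>) - m)\<^sup>2 + (2 * m * normP (V 1 \<omega>) - m\<^sup>2))"
    using assms(8,9) unfolding m_def by (intro Bochner_Integration.integrable_add) auto
  then have sq: "integrable M (\<lambda>\<omega>. (normP (V 1 \<omega>))\<^sup>2)"
    by (simp add: power2_diff algebra_simps)
  obtain D :: "'a set" where D: "countable D" "\<And>U. open U \<Longrightarrow> U \<noteq> {} \<Longrightarrow> \<exists>d\<in>D. d \<in> U"
    using countable_dense_setE by blast
  \<comment> \<open>Each \<open>w\<close> has its own null set; countability of \<open>D\<close>
    merges them into one.\<close>
  have "AE \<omega> in M. \<forall>w\<in>D. (\<lambda>n. (\<Sum>k\<in>{1..n}. support_fun (fnl w) (V k \<omega>)) / real n)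
      \<longlonglongrightarrow> support_fun (fnl w) (aumann_expectation M (V 1))"
    unfolding AE_ball_countable[OF D(1)] support_fun_aumann_expectation[OF V1 assms(1)]
    using strong_law_support_fun[OF assms(1) V assms(6,7) sq] by blast
  then show ?thesis
    using AE_space
  proof eventually_elim
    fix \<omega>
    assume lim: "\<forall>w\<in>D. (\<lambda>n. (\<Sum>k\<in>{1..n}. support_fun (fnl w) (V k \<omega>)) / real n)
        \<longlonglongrightarrow> support_fun (fnl w) (aumann_expectation M (V 1))"
      and \<omega>: "\<omega> \<in> space M"
    have sum: "(\<Sum>k\<in>{1..n}. V k \<omega>) \<noteq> {}" "convex (\<Sum>k\<in>{1..n}. V k \<omega>)" "bounded (\<Sum>k\<in>{1..n}. V k \<omega>)"
      "support_fun x (\<Sum>k\<in>{1..n}. V k \<omega>) = (\<Sum>k\<in>{1..n}. support_fun x (V k \<omega>))" for n x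
      using Minkowski_sum_support_fun[of "{1..n}" "\<lambda>k. V k \<omega>" x] V_Pkc[OF _ \<omega>] by auto
    show "(\<lambda>n. hausdorff ((*\<^sub>R) (1 / real n) ` (\<Sum>k\<in>{1..n}. V k \<omega>)) (aumann_expectation M (V 1)))
        \<longlonglongrightarrow> 0"
    proof (rule hausdorff_tendsto_0_if_support_tendsto[OF aumann_expectation_nonempty[OF V1]
          aumann_expectation_convex[OF V1] aumann_expectation_bounded[OF V1] _ _ _ D(2)])
      fix n
      show "(*\<^sub>R) (1 / real n) ` (\<Sum>k\<in>{1..n}. V k \<omega>) \<noteq> {}" using sum(1) by simp
      show "convex ((*\<^sub>R) (1 / real n) ` (\<Sum>k\<in>{1..n}. V k \<omega>))" using sum(2) by (rule convex_scaling)
      show "bounded ((*\<^sub>R) (1 / real n) ` (\<Sum>k\<in>{1..n}. V k \<omega>))" using sum(3) by (rule bounded_scaling)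
    next
      fix w assume "w \<in> D"
      have "support_fun (fnl w) ((*\<^sub>R) (1 / real n) ` (\<Sum>k\<in>{1..n}. V k \<omega>)) =
          (\<Sum>k\<in>{1..n}. support_fun (fnl w) (V k \<omega>)) / real n" for n
        using support_fun_scaleR[OF sum(1,3)[of n], of "1 / real n" "fnl w"]
        unfolding sum(4) by simp
      then show "(\<lambda>n. support_fun (fnl w) ((*\<^sub>R) (1 / real n) ` (\<Sum>k\<in>{1..n}. V k \<omega>)))
          \<longlonglongrightarrow> support_fun (fnl w) (aumann_expectation M (V 1))"
        using bspec[OF lim \<open>w \<in> D\<close>] by (simp only:)
    qed
  qed
qed

end
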